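(* Let $d\ge2$ and let $\Omega\subsetneq\mathbb R^d$ be a domain satisfying the local harmonic measure decay property with exponent $\alpha>0$, with constant $M_\alpha$. Then for any $\beta\in(0,\alpha)$ there exists a superharmonic function $\phi$ on $\Omega$ satisfying $$N^{-1}\rho^\beta\le\phi\le N\rho^\beta,$$ where $N=N(\alpha,\beta,M_\alpha)>0$.
   Context: $\rho(x)=d(x,\partial\Omega)$. A function $\phi\in L^1_{loc}(\Omega)$ is superharmonic if $\int_\Omega\phi\,\Delta\zeta\,dx\le0$ for all $0\le\zeta\in C_c^\infty(\Omega)$. For a bounded open set $U\subset\mathbb R^d$ and a Borel set $E\subset\partial U$, the harmonic measure $w(\cdot,U,E)$ is the Perron–Wiener–Brelot solution with boundary data $1_E$, i.e. $w(x,U,E)=\inf\phi(x)$ over all classical superharmonic functions $\phi$ on $U$ (lower semicontinuous, super-mean-value property on balls, not identically $+\infty$ on any component) with $\liminf_{y\to z}\phi(y)\ge1_E(z)$ for all $z\in\partial U$. For $p\in\partial\Omega$, $r>0$, $w(\cdot,p,r)=w\big(\cdot,\Omega\cap B_r(p),\Omega\cap\partial B_r(p)\big)$. $\Omega$ satisfies the local harmonic measure decay property with exponent $\alpha>0$ if there is a constant $M_\alpha>0$, depending only on $\Omega$ and $\alpha$, such that $w(x,p,r)\le M_\alpha(|x-p|/r)^\alpha$ for all $x\in\Omega\cap B(p,r)$, whenever $p\in\partial\Omega$ and $r>0$. *)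

theory Defs
  imports "HOL-Analysis.Analysis"
begin

text \<open>
  The constant in the theorem is uniform in the dimension, so the dimension has to be a
  quantified natural number rather than a type. A point of \<open>\<real>\<^sup>d\<close> is a function on \<open>{..<d}\<close>,
  extended by \<^const>\<open>undefined\<close>; this is also the carrier of the product measure
  \<open>PiM {..<d} (\<lambda>_. lborel)\<close>.
\<close>

definition Rd :: "nat \<Rightarrow> (nat \<Rightarrow> real) set" where
  "Rd d = ({..<d} \<rightarrow>\<^sub>E UNIV)"

definition edist :: "nat \<Rightarrow> (nat \<Rightarrow> real) \<Rightarrow> (nat \<Rightarrow> real) \<Rightarrow> real" where
  "edist d x y = L2_set (\<lambda>i. x i - y i) {..<d}"

lemma Metric_space_Rd: "Metric_space (Rd d) (edist d)"
proof
  fix x y z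
  show "0 \<le> edist d x y"
    by (simp add: edist_def)
  show "edist d x y = edist d y x"
    by (simp add: edist_def L2_set_def power2_commute)
  show "edist d x y = 0 \<longleftrightarrow> x = y" if "x \<in> Rd d" "y \<in> Rd d"
    using that by (auto simp: edist_def L2_set_eq_0_iff Rd_def intro: PiE_ext)
  show "edist d x z \<le> edist d x y + edist d y z"
    using L2_set_triangle_ineq[of "\<lambda>i. x i - y i" "\<lambda>i. y i - z i" "{..<d}"]
    by (simp add: edist_def)
qed

abbreviation etop :: "nat \<Rightarrow> (nat \<Rightarrow> real) topology" where
  "etop d \<equiv> Metric_space.mtopology (Rd d) (edist d)"

abbreviation eball :: "nat \<Rightarrow> (nat \<Rightarrow> real) \<Rightarrow> real \<Rightarrow> (nat \<Rightarrow> real) set" where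
  "eball d \<equiv> Metric_space.mball (Rd d) (edist d)"

abbreviation ecball :: "nat \<Rightarrow> (nat \<Rightarrow> real) \<Rightarrow> real \<Rightarrow> (nat \<Rightarrow> real) set" where
  "ecball d \<equiv> Metric_space.mcball (Rd d) (edist d)"

definition leb :: "nat \<Rightarrow> (nat \<Rightarrow> real) measure" where
  "leb d = completion (PiM {..<d} (\<lambda>_. lborel))"

lemma space_leb: "space (leb d) = Rd d"
  by (simp add: leb_def Rd_def space_PiM)

definition domain_in :: "nat \<Rightarrow> (nat \<Rightarrow> real) set \<Rightarrow> bool" where
  "domain_in d \<Omega> \<longleftrightarrow> openin (etop d) \<Omega> \<and> connectedin (etop d) \<Omega> \<and> \<Omega> \<noteq> {}"

definition bdist :: "nat \<Rightarrow> (nat \<Rightarrow> real) set \<Rightarrow> (nat \<Rightarrow> real) \<Rightarrow> real" where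
  "bdist d \<Omega> x = (INF z\<in>etop d frontier_of \<Omega>. edist d x z)"

subsection \<open>Superharmonic functions in the sense of distributions\<close>

definition partial :: "nat \<Rightarrow> ((nat \<Rightarrow> real) \<Rightarrow> real) \<Rightarrow> (nat \<Rightarrow> real) \<Rightarrow> real" where
  "partial i f x = deriv (\<lambda>t. f (x(i := t))) (x i)"

definition smooth :: "nat \<Rightarrow> ((nat \<Rightarrow> real) \<Rightarrow> real) \<Rightarrow> bool" where
  "smooth d f \<longleftrightarrow> (\<forall>is. set is \<subseteq> {..<d} \<longrightarrow>
     continuous_map (etop d) euclideanreal (fold partial is f) \<and>
     (\<forall>x\<in>Rd d. \<forall>j<d. (\<lambda>t. fold partial is f (x(j := t))) differentiable (at (x j))))"

definition laplacian :: "nat \<Rightarrow> ((nat \<Rightarrow> real) \<Rightarrow> real) \<Rightarrow> (nat \<Rightarrow> real) \<Rightarrow> real" where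
  "laplacian d f x = (\<Sum>i<d. partial i (partial i f) x)"

text \<open>Elements of \<open>C\<^sub>c\<^sup>\<infinity>(\<Omega>)\<close> are represented by their extension by zero to \<open>\<real>\<^sup>d\<close>.\<close>

definition test_function :: "nat \<Rightarrow> (nat \<Rightarrow> real) set \<Rightarrow> ((nat \<Rightarrow> real) \<Rightarrow> real) \<Rightarrow> bool" where
  "test_function d \<Omega> \<zeta> \<longleftrightarrow> smooth d \<zeta> \<and>
     compactin (etop d) (etop d closure_of {x \<in> Rd d. \<zeta> x \<noteq> 0}) \<and>
     etop d closure_of {x \<in> Rd d. \<zeta> x \<noteq> 0} \<subseteq> \<Omega>"

definition locally_integrable :: "nat \<Rightarrow> (nat \<Rightarrow> real) set \<Rightarrow> ((nat \<Rightarrow> real) \<Rightarrow> real) \<Rightarrow> bool" where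
  "locally_integrable d \<Omega> \<phi> \<longleftrightarrow>
     (\<forall>K. compactin (etop d) K \<and> K \<subseteq> \<Omega> \<longrightarrow> set_integrable (leb d) K \<phi>)"

definition superharmonic :: "nat \<Rightarrow> (nat \<Rightarrow> real) set \<Rightarrow> ((nat \<Rightarrow> real) \<Rightarrow> real) \<Rightarrow> bool" where
  "superharmonic d \<Omega> \<phi> \<longleftrightarrow> locally_integrable d \<Omega> \<phi> \<and>
     (\<forall>\<zeta>. test_function d \<Omega> \<zeta> \<and> (\<forall>x\<in>Rd d. 0 \<le> \<zeta> x) \<longrightarrow>
        (LINT x:\<Omega>|leb d. \<phi> x * laplacian d \<zeta> x) \<le> 0)"

subsection \<open>Harmonic measure\<close>

text \<open>
  Mean value over a ball, as the difference of the means of the positive and negative parts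
  (\<^const>\<open>e2ennreal\<close> maps negative values to 0). A lower semicontinuous function that never
  equals \<open>-\<infinity>\<close> is bounded below on closed balls, so for such functions the second term is finite.
\<close>

definition ball_mean :: "nat \<Rightarrow> (nat \<Rightarrow> real) \<Rightarrow> real \<Rightarrow> ((nat \<Rightarrow> real) \<Rightarrow> ereal) \<Rightarrow> ereal" where
  "ball_mean d x r \<phi> =
     enn2ereal (\<integral>\<^sup>+y. e2ennreal (\<phi> y) \<partial>uniform_measure (leb d) (ecball d x r)) -
     enn2ereal (\<integral>\<^sup>+y. e2ennreal (- \<phi> y) \<partial>uniform_measure (leb d) (ecball d x r))"

definition classical_superharmonic ::
    "nat \<Rightarrow> (nat \<Rightarrow> real) set \<Rightarrow> ((nat \<Rightarrow> real) \<Rightarrow> ereal) \<Rightarrow> bool" where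
  "classical_superharmonic d U \<phi> \<longleftrightarrow>
     (\<forall>x\<in>U. \<phi> x \<noteq> -\<infinity>) \<and>
     (\<forall>a. openin (etop d) {x \<in> U. a < \<phi> x}) \<and>
     (\<forall>x\<in>U. \<forall>r>0. ecball d x r \<subseteq> U \<longrightarrow> ball_mean d x r \<phi> \<le> \<phi> x) \<and>
     (\<forall>C\<in>connected_components_of (subtopology (etop d) U). \<exists>x\<in>C. \<phi> x \<noteq> \<infinity>)"

definition upper_class ::
    "nat \<Rightarrow> (nat \<Rightarrow> real) set \<Rightarrow> (nat \<Rightarrow> real) set \<Rightarrow> ((nat \<Rightarrow> real) \<Rightarrow> ereal) set" where
  "upper_class d U E = {\<phi>. classical_superharmonic d U \<phi> \<and>
     (\<forall>z\<in>etop d frontier_of U. indicator E z \<le> Liminf (atin_within (etop d) z U) \<phi>)}"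

definition harmonic_measure ::
    "nat \<Rightarrow> (nat \<Rightarrow> real) \<Rightarrow> (nat \<Rightarrow> real) set \<Rightarrow> (nat \<Rightarrow> real) set \<Rightarrow> ereal" where
  "harmonic_measure d x U E = (INF \<phi>\<in>upper_class d U E. \<phi> x)"

definition local_harmonic_measure ::
    "nat \<Rightarrow> (nat \<Rightarrow> real) set \<Rightarrow> (nat \<Rightarrow> real) \<Rightarrow> (nat \<Rightarrow> real) \<Rightarrow> real \<Rightarrow> ereal" where
  "local_harmonic_measure d \<Omega> x p r =
     harmonic_measure d x (\<Omega> \<inter> eball d p r) (\<Omega> \<inter> etop d frontier_of (eball d p r))"

definition LHMD :: "nat \<Rightarrow> (nat \<Rightarrow> real) set \<Rightarrow> real \<Rightarrow> real \<Rightarrow> bool" where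
  "LHMD d \<Omega> \<alpha> M \<longleftrightarrow>
     (\<forall>p\<in>etop d frontier_of \<Omega>. \<forall>r>0. \<forall>x\<in>\<Omega> \<inter> eball d p r.
        local_harmonic_measure d \<Omega> x p r \<le> ereal (M * (edist d x p / r) powr \<alpha>))"

end

theory Submission
  imports Defs
begin

text \<open>
  Fix a small ratio \<open>\<theta>\<close> with \<open>M \<theta>\<^sup>\<alpha> \<le> \<theta>\<^sup>\<beta> / 4\<close> and put \<open>\<epsilon> = \<theta>\<^sup>\<beta> / 8\<close>. For every boundary point \<open>p\<close>,
  radius \<open>r\<close> and \<open>\<psi>\<close> in the upper class of the harmonic measure of \<open>\<Omega> \<inter> B(p, r)\<close>, the function
  \<open>r\<^sup>\<beta> (\<psi> + \<epsilon>)\<close> is superharmonic on \<open>\<Omega> \<inter> B(p, r)\<close> and at least \<open>\<epsilon> \<rho>\<^sup>\<beta>\<close> there, and the decay property makes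
  the infimum \<open>\<phi>(y)\<close> over all of them with \<open>y \<in> B(p, r)\<close> comparable to \<open>\<rho>(y)\<^sup>\<beta>\<close>. A function of the
  family with \<open>r\<close> comparable to \<open>\<rho>(y)\<close> (those with larger \<open>r\<close> are too big to matter) and \<open>y\<close> near
  \<open>\<partial>B(p, r)\<close> does not spoil the super-mean-value property: \<open>\<psi>\<close> is at least \<open>1/2\<close> at \<open>y\<close>, so by the
  choice of \<open>\<theta>\<close> the functions with centre \<open>p\<close> and radius \<open>r / \<theta>\<close> lie below it, and these are
  defined on a ball around \<open>y\<close> of radius comparable to \<open>\<rho>(y)\<close>. Hence the lower semicontinuous regularization
  of \<open>\<phi>\<close> has the super-mean-value property on balls of radius up to a multiple of \<open>\<rho>\<close>, and is superharmonic.
\<close>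

section \<open>Geometry of the coordinate space\<close>

text \<open>The gap \<beta> < \<alpha> pays for passing from radius r to r / \<theta>: the weight
  grows by \<theta>^(-\<beta>), the decay gains \<theta>^\<alpha>, and (r / \<theta>)^\<beta> (M
  \<theta>^\<alpha> + 2 \<epsilon>) = r^\<beta> (M \<theta>^(\<alpha> - \<beta>) + 1/4) \<le>
  r^\<beta> / 2. One of the two \<epsilon> belongs to the candidate, the other is slack, because the
  infimum defining harmonic measure need not be attained. The candidates carry \<epsilon> since
  \<psi> itself is only known to be nonnegative. An infimum over an uncountable family need not be
  measurable, so means are taken of the regularization only. Its mean over a ball is first compared
  with the unregularized infimum at the centre, where each candidate can be treated separately.
  Fatou's lemma along centres z_n \<rightarrow> x, chosen so that the infimum at z_n approaches the
  regularization at x, then gives the inequality at x. N is built from \<beta>, M, \<theta> and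
  \<epsilon>, all fixed before the dimension and the domain. The remaining constants only limit the
  radii of the balls.\<close>

interpretation Rd: Metric_space "Rd d" "edist d" for d
  by (rule Metric_space_Rd)

abbreviation lebP :: "nat \<Rightarrow> (nat \<Rightarrow> real) measure" where
  "lebP d \<equiv> PiM {..<d} (\<lambda>_. lborel)"

abbreviation orig :: "nat \<Rightarrow> nat \<Rightarrow> real" where
  "orig d \<equiv> (\<lambda>i\<in>{..<d}. 0)"

lemma orig_in_Rd: "orig d \<in> Rd d"
  by (simp add: Rd_def)

lemma Rd_iff: "x \<in> Rd d \<longleftrightarrow> x \<in> extensional {..<d}"
  by (simp add: Rd_def PiE_iff)

lemma restrict_in_Rd: "restrict x {..<d} \<in> Rd d"
  by (simp add: Rd_iff)

lemma space_lebP: "space (lebP d) = Rd d"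
  by (simp add: Rd_def space_PiM)

lemma fun_upd_in_Rd: "x \<in> Rd d \<Longrightarrow> i < d \<Longrightarrow> x(i := s) \<in> Rd d"
  by (auto simp: Rd_def PiE_iff extensional_def)

lemma component_le_edist: "i < d \<Longrightarrow> \<bar>x i - y i\<bar> \<le> edist d x y"
  using member_le_L2_set[of "{..<d}" i "\<lambda>i. \<bar>x i - y i\<bar>"]
  by (simp add: edist_def L2_set_def)

lemma edist_le_sum: "edist d x y \<le> (\<Sum>i<d. \<bar>x i - y i\<bar>)"
  unfolding edist_def by (rule L2_set_le_sum_abs)

lemma edist_sq: "(edist d x y)\<^sup>2 = (\<Sum>i<d. (x i - y i)\<^sup>2)"
  by (simp add: edist_def L2_set_def sum_nonneg)

lemma edist_mono:
  assumes "\<And>i. i < d \<Longrightarrow> \<bar>x i - y i\<bar> \<le> \<bar>u i - v i\<bar>"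
  shows "edist d x y \<le> edist d u v"
  unfolding edist_def L2_set_def
  by (intro real_sqrt_le_mono sum_mono) (use assms in \<open>auto simp: abs_le_square_iff\<close>)

lemma edist_triangle: "edist d x z \<le> edist d x y + edist d y z"
  using L2_set_triangle_ineq[of "\<lambda>i. x i - y i" "\<lambda>i. y i - z i" "{..<d}"]
  by (simp add: edist_def)

lemma edist_commute: "edist d x y = edist d y x"
  by (simp add: edist_def L2_set_def power2_commute)

section \<open>Topology of the coordinate space: product description, compactness,
  measurability\<close>

lemma etop_eq_product_topology: "etop d = product_topology (\<lambda>_. euclideanreal) {..<d}"
proof (rule topology_eq[THEN iffD2], intro allI iffI)
  fix S assume S: "openin (etop d) S"
  show "openin (product_topology (\<lambda>_. euclideanreal) {..<d}) S"
    unfolding openin_product_topology_alt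
  proof
    fix x assume x: "x \<in> S"
    then obtain r where r: "r > 0" "eball d x r \<subseteq> S"
      using S by (auto simp: Rd.openin_mtopology)
    have xR: "x \<in> Rd d" using S x by (auto simp: Rd.openin_mtopology)
    \<comment> \<open>The sum of the coordinate differences is at most \<open>real d * e\<close>;
      the \<open>+ 1\<close> makes this smaller than \<open>r\<close> and covers
      \<open>d = 0\<close>.\<close>
    define e where "e = r / (real d + 1)"
    have e: "e > 0" using r by (simp add: e_def)
    define U where "U = (\<lambda>i::nat. {x i - e <..< x i + e})"
    have sub: "PiE {..<d} U \<subseteq> S"
    proof
      fix y assume y: "y \<in> PiE {..<d} U"
      then have "edist d x y \<le> (\<Sum>i<d. e)"
        by (intro order_trans[OF edist_le_sum] sum_mono) (force simp: U_def PiE_iff abs_le_iff)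
      also have "\<dots> = real d * e" by simp
      also have "\<dots> < (real d + 1) * e" using e by (simp add: algebra_simps)
      also have "\<dots> = r" by (simp add: e_def)
      finally show "y \<in> S" using y xR r by (auto simp: Rd_iff PiE_iff subset_iff)
    qed
    show "\<exists>U. finite {i \<in> {..<d}. U i \<noteq> topspace euclideanreal} \<and>
       (\<forall>i\<in>{..<d}. openin euclideanreal (U i)) \<and> x \<in> PiE {..<d} U \<and> PiE {..<d} U \<subseteq> S"
      using sub e xR by (intro exI[of _ U]) (auto simp: U_def Rd_def PiE_iff)
  qed
next
  fix S assume S: "openin (product_topology (\<lambda>_. euclideanreal) {..<d}) S"
  show "openin (etop d) S"
    unfolding Rd.openin_mtopology
  proof (intro conjI allI impI)
    show "S \<subseteq> Rd d" using openin_subset[OF S] by (simp add: Rd_def)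
    fix x assume x: "x \<in> S"
    obtain U where U: "\<And>i. i < d \<Longrightarrow> open (U i)" "x \<in> PiE {..<d} U" "PiE {..<d} U \<subseteq> S"
      using bspec[OF S[unfolded openin_product_topology_alt] x] by auto
    have "\<forall>i. \<exists>e>0. i < d \<longrightarrow> ball (x i) e \<subseteq> U i"
    proof
      fix i show "\<exists>e>0. i < d \<longrightarrow> ball (x i) e \<subseteq> U i"
        using U(1)[of i] U(2) open_contains_ball[of "U i"] 
        by (cases "i < d") (auto simp: PiE_iff intro: exI[of _ 1])
    qed
    then obtain e where e: "\<And>i. e i > 0" "\<And>i. i < d \<Longrightarrow> ball (x i) (e i) \<subseteq> U i" by metis
    \<comment> \<open>The inserted 1 keeps \<open>Min\<close> meaningful for
      \<open>d = 0\<close>.\<close>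
    define r where "r = Min (insert 1 (e ` {..<d}))"
    have r: "r > 0" "\<And>i. i < d \<Longrightarrow> r \<le> e i"
      using e(1) by (auto simp: r_def)
    have "eball d x r \<subseteq> S"
    proof
      fix y assume y: "y \<in> eball d x r"
      have "y i \<in> U i" if "i < d" for i
        using component_le_edist[OF that, of x y] y r(2)[OF that] e(2)[OF that]
        by (auto simp: dist_real_def subset_iff)
      then have "y \<in> PiE {..<d} U" using y by (auto simp: Rd_iff PiE_iff)
      then show "y \<in> S" using U(3) by auto
    qed
    then show "\<exists>r>0. eball d x r \<subseteq> S" using r by auto
  qed
qed

text \<open>The dimension is a variable and not a type, so Heine-Borel is obtained from compactness
  of a product of closed intervals, in which the ball is a closed subset.\<close>

lemma compactin_ecball: "compactin (etop d) (ecball d x r)"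
proof -
  let ?B = "PiE {..<d} (\<lambda>i. {x i - r .. x i + r})"
  have "compactin (etop d) ?B"
    by (simp add: etop_eq_product_topology compactin_PiE)
  moreover have "ecball d x r \<subseteq> ?B"
  proof
    fix y assume "y \<in> ecball d x r"
    then have "x i - r \<le> y i \<and> y i \<le> x i + r" if "i < d" for i
      using component_le_edist[OF that, of x y] by auto
    then show "y \<in> ?B"
      using \<open>y \<in> ecball d x r\<close> by (auto simp: Rd_iff PiE_iff)
  qed
  ultimately show ?thesis
    using closed_compactin[OF _ _ Rd.closedin_mcball] by blast
qed

text \<open>Prepares the measurability of open sets: on the full function space
  \<open>nat \<Rightarrow> real\<close> the Borel sets are known to be those of the countable
  product, and \<open>U\<close> turns into an open cylinder there.\<close>

lemma open_restrict_vimage: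
  assumes "openin (etop d) U"
  shows "open {z :: nat \<Rightarrow> real. restrict z {..<d} \<in> U}"
  unfolding open_subopen[of "{z. restrict z {..<d} \<in> U}"]
proof
  fix z assume "z \<in> {z :: nat \<Rightarrow> real. restrict z {..<d} \<in> U}"
  then obtain r where r: "r > 0" "eball d (restrict z {..<d}) r \<subseteq> U"
    using assms by (auto simp: Rd.openin_mtopology)
  let ?V = "{w. edist d z w < r}"
  have "continuous_on UNIV (\<lambda>w. edist d z w)"
    unfolding edist_def L2_set_def
    by (intro continuous_intros) auto
  then have "open ?V" by (intro open_Collect_less continuous_intros) auto
  moreover have "?V \<subseteq> {z. restrict z {..<d} \<in> U}"
  proof
    fix w assume "w \<in> ?V"
    then have "edist d (restrict z {..<d}) (restrict w {..<d}) < r"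
      by (simp add: edist_def L2_set_def)
    then show "w \<in> {z. restrict z {..<d} \<in> U}" using r(2) restrict_in_Rd by auto
  qed
  ultimately show "\<exists>T. open T \<and> z \<in> T \<and> T \<subseteq> {z. restrict z {..<d} \<in> U}"
    using r(1) by (intro exI[of _ ?V]) (auto simp: edist_def L2_set_def)
qed

text \<open>Extension by 0 is a measurable map from \<open>Rd d\<close> to
  \<open>nat \<Rightarrow> real\<close>, and \<open>U\<close> is its preimage of the open cylinder
  over \<open>U\<close>.\<close>

lemma openin_sets_lebP: 
  assumes "openin (etop d) U" shows "U \<in> sets (lebP d)"
proof -
  let ?f = "\<lambda>x i. if i < d then x i else (0::real)"
  have "?f \<in> measurable (lebP d) (PiM UNIV (\<lambda>_. borel))"
  proof (rule measurable_PiM_single')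
    fix i :: nat
    show "(\<lambda>x. if i < d then x i else (0::real)) \<in> measurable (lebP d) borel"
    proof (cases "i < d")
      case True
      then have "(\<lambda>x. x i) \<in> measurable (lebP d) lborel" by (intro measurable_component_singleton) auto
      with True show ?thesis by simp
    qed simp
  qed simp
  then have "?f \<in> measurable (lebP d) borel"
    by (subst measurable_cong_sets[OF refl sets_PiM_equal_borel[symmetric]])
  then have "?f -` {z. restrict z {..<d} \<in> U} \<inter> space (lebP d) \<in> sets (lebP d)"
    using open_restrict_vimage[OF assms] by (intro measurable_sets[of _ _ borel]) auto
  moreover have "?f -` {z. restrict z {..<d} \<in> U} \<inter> space (lebP d) = U"
  proof -
    have "restrict (?f x) {..<d} = x" if "x \<in> Rd d" for x
      using that by (auto simp: Rd_def PiE_iff extensional_def fun_eq_iff)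
    moreover have "U \<subseteq> Rd d" using openin_subset[OF assms] by simp
    ultimately show ?thesis by (auto simp: space_lebP)
  qed
  ultimately show ?thesis by simp
qed

lemma closedin_sets_lebP: 
  assumes "closedin (etop d) K" shows "K \<in> sets (lebP d)"
proof -
  have "Rd d - K \<in> sets (lebP d)" using assms by (intro openin_sets_lebP) (simp add: closedin_def)
  then have "Rd d - (Rd d - K) \<in> sets (lebP d)"
    using sets.compl_sets space_lebP by metis
  moreover have "K \<subseteq> Rd d" using closedin_subset[OF assms] by simp
  ultimately show ?thesis by (simp add: double_diff)
qed

lemma ecball_sets [measurable]: "ecball d x r \<in> sets (lebP d)"
  by (rule closedin_sets_lebP) simp

lemma continuous_map_measurable:
  assumes "continuous_map (etop d) euclideanreal f"
  shows "f \<in> borel_measurable (lebP d)"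
proof (rule borel_measurableI)
  fix S :: "real set" assume "open S"
  then have "openin (etop d) {x \<in> topspace (etop d). f x \<in> S}"
    using assms by (intro openin_continuous_map_preimage[of _ euclideanreal]) auto
  moreover have "{x \<in> topspace (etop d). f x \<in> S} = f -` S \<inter> space (lebP d)"
    by (auto simp: space_lebP)
  ultimately show "f -` S \<inter> space (lebP d) \<in> sets (lebP d)"
    using openin_sets_lebP by metis
qed

lemma continuous_map_component: "i < d \<Longrightarrow> continuous_map (etop d) euclideanreal (\<lambda>x. x i)"
  using continuous_map_product_projection[of i "{..<d}" "\<lambda>_. euclideanreal"]
  by (simp add: etop_eq_product_topology)

lemma continuous_map_edist:
  "continuous_map (etop d) euclideanreal (\<lambda>x. edist d x y)"
proof -
  have "continuous_map (etop d) euclideanreal (\<lambda>x. \<Sum>i<d. (x i - y i)\<^sup>2)"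
    by (intro continuous_map_sum continuous_map_real_pow continuous_map_diff continuous_map_component) auto
  moreover have "continuous_map euclideanreal euclideanreal sqrt"
    unfolding continuous_map_iff_continuous2 by (intro continuous_intros)
  ultimately have "continuous_map (etop d) euclideanreal (sqrt \<circ> (\<lambda>x. \<Sum>i<d. (x i - y i)\<^sup>2))"
    by (rule continuous_map_compose)
  then show ?thesis by (simp add: o_def edist_def L2_set_def)
qed

section \<open>Boundary points and the distance to the boundary\<close>

lemma segment_meets_frontier:
  assumes x: "x \<in> S" "x \<in> Rd d" and y: "y \<notin> S" "y \<in> Rd d"
  obtains z where "z \<in> etop d frontier_of S" "edist d x z \<le> edist d x y"
proof -
  let ?p = "\<lambda>t::real. \<lambda>i\<in>{..<d}. (1 - t) * x i + t * y i"
  have "continuous_map (top_of_set {0..1}) (etop d) ?p"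
    unfolding etop_eq_product_topology
    by (subst continuous_map_componentwise) (auto intro!: continuous_intros)
  then have conn: "connectedin (etop d) (?p ` {0..1})"
    by (rule connectedin_continuous_map_image) (simp add: connectedin_subtopology)
  have p0: "?p 0 = x" and p1: "?p 1 = y"
    using x y by (auto simp: Rd_def PiE_iff extensional_def fun_eq_iff)
  have "x \<in> ?p ` {0..1}" "y \<in> ?p ` {0..1}"
    by (rule image_eqI[where x = 0], use p0 in simp, simp)
       (rule image_eqI[where x = 1], use p1 in simp, simp)
  then have "?p ` {0..1} \<inter> S \<noteq> {}" "?p ` {0..1} - S \<noteq> {}"
    using x y by blast+
  then obtain t where t: "t \<in> {0..1}" "?p t \<in> etop d frontier_of S"
    using connectedin_Int_frontier_of[OF conn] by blast
  have "edist d x (?p t) \<le> edist d x y"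
  proof (rule edist_mono)
    fix i assume "i < d"
    then have "x i - ?p t i = t * (x i - y i)" by (simp add: algebra_simps)
    then show "\<bar>x i - ?p t i\<bar> \<le> \<bar>x i - y i\<bar>"
      using t by (auto simp: abs_mult intro: mult_left_le_one_le)
  qed
  with t that show thesis by blast
qed

lemma frontier_in_Rd: "z \<in> etop d frontier_of S \<Longrightarrow> z \<in> Rd d"
  using frontier_of_subset_topspace[of "etop d" S] by auto

lemma frontier_nonempty:
  assumes "\<Omega> \<noteq> {}" "\<Omega> \<subset> Rd d"
  shows "etop d frontier_of \<Omega> \<noteq> {}"
proof -
  obtain x y where "x \<in> \<Omega>" "y \<in> Rd d - \<Omega>" using assms by auto
  with assms(2) segment_meets_frontier[of x \<Omega> d y] show ?thesis by auto
qed

lemma bdist_le: "z \<in> etop d frontier_of \<Omega> \<Longrightarrow> bdist d \<Omega> x \<le> edist d x z"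
  unfolding bdist_def by (intro cINF_lower bdd_belowI[of _ 0]) auto

lemma bdist_less_obtains:
  assumes "etop d frontier_of \<Omega> \<noteq> {}" "bdist d \<Omega> x < r"
  obtains z where "z \<in> etop d frontier_of \<Omega>" "edist d x z < r"
  using assms unfolding bdist_def by (subst (asm) cINF_less_iff) (auto intro!: bdd_belowI[of _ 0])

lemma bdist_greatest:
  assumes "etop d frontier_of \<Omega> \<noteq> {}" "\<And>z. z \<in> etop d frontier_of \<Omega> \<Longrightarrow> c \<le> edist d x z"
  shows "c \<le> bdist d \<Omega> x"
  using assms unfolding bdist_def by (intro cINF_greatest)

lemma bdist_lipschitz:
  assumes "etop d frontier_of \<Omega> \<noteq> {}"
  shows "bdist d \<Omega> x \<le> bdist d \<Omega> y + edist d x y"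
proof -
  have "bdist d \<Omega> x - edist d x y \<le> bdist d \<Omega> y"
  proof (rule bdist_greatest[OF assms])
    fix z assume "z \<in> etop d frontier_of \<Omega>"
    then show "bdist d \<Omega> x - edist d x y \<le> edist d y z"
      using bdist_le[of z d \<Omega> x] edist_triangle[of d x z y] by linarith
  qed
  then show ?thesis by linarith
qed


lemma le_bdist_of_eball_subset:
  assumes "openin (etop d) \<Omega>" "x \<in> \<Omega>" "etop d frontier_of \<Omega> \<noteq> {}" "eball d x r \<subseteq> \<Omega>"
  shows "r \<le> bdist d \<Omega> x"
proof (rule bdist_greatest[OF assms(3)])
  fix z assume z: "z \<in> etop d frontier_of \<Omega>"
  then have "z \<notin> \<Omega>" using assms(1) by (simp add: frontier_of_def interior_of_openin)
  then show "r \<le> edist d x z"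
    using z assms openin_subset[OF assms(1)] frontier_in_Rd[OF z] by (force simp: not_le[symmetric])
qed

lemma bdist_pos:
  assumes "openin (etop d) \<Omega>" "x \<in> \<Omega>" "etop d frontier_of \<Omega> \<noteq> {}"
  shows "0 < bdist d \<Omega> x"
proof -
  obtain r where "r > 0" "eball d x r \<subseteq> \<Omega>"
    using assms(1,2) unfolding Rd.openin_mtopology by blast
  then show ?thesis using le_bdist_of_eball_subset[OF assms, of r] by linarith
qed

lemma mem_of_edist_less_bdist:
  assumes "x \<in> \<Omega>" "x \<in> Rd d" "y \<in> Rd d" "edist d x y < bdist d \<Omega> x"
  shows "y \<in> \<Omega>"
proof (rule ccontr)
  assume "y \<notin> \<Omega>"
  then obtain z where "z \<in> etop d frontier_of \<Omega>" "edist d x z \<le> edist d x y"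
    using segment_meets_frontier assms by metis
  then show False using bdist_le[of z d \<Omega> x] assms by linarith
qed

section \<open>Lebesgue measure and ball means\<close>

interpretation lebP: product_sigma_finite "\<lambda>_. lborel :: real measure"
  by standard

lemma sigma_finite_lebP: "sigma_finite_measure (lebP d)"
  by (rule lebP.sigma_finite) simp

text \<open>One family for all symmetries of the ball that occur: translations, reflections in one
  coordinate and transpositions of two coordinates. With signs \<open>s k\<close> equal to 1 or -1
  and a permutation \<open>\<sigma>\<close> these are isometries.\<close>

definition aff :: "nat \<Rightarrow> (nat \<Rightarrow> real) \<Rightarrow> (nat \<Rightarrow> real) \<Rightarrow> (nat \<Rightarrow> nat) \<Rightarrow> (nat \<Rightarrow> real) \<Rightarrow> nat \<Rightarrow> real"
  where "aff d c s \<sigma> v = (\<lambda>k\<in>{..<d}. c k + s k * v (\<sigma> k))"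

lemma aff_in_Rd: "aff d c s \<sigma> v \<in> Rd d"
  by (simp add: aff_def restrict_in_Rd)

lemma measurable_aff [measurable]:
  assumes "bij_betw \<sigma> {..<d} {..<d}"
  shows "aff d c s \<sigma> \<in> measurable (lebP d) (lebP d)"
proof -
  have "(\<lambda>v. v (\<sigma> k)) \<in> borel_measurable (lebP d)" if "k < d" for k
  proof -
    have "\<sigma> k < d" using assms that by (auto simp: bij_betw_def)
    then have "(\<lambda>v. v (\<sigma> k)) \<in> measurable (lebP d) lborel" 
      by (intro measurable_component_singleton) auto
    then show ?thesis by simp
  qed
  then show ?thesis
    unfolding aff_def by (intro measurable_restrict) (auto intro!: borel_measurable_add borel_measurable_times)
qed

lemma emeasure_lborel_affine_vimage:
  fixes A :: "real set"
  assumes "s = 1 \<or> s = - 1" "A \<in> sets borel"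
  shows "emeasure lborel ((\<lambda>t. c + s * t) -` A) = emeasure lborel A"
proof -
  have "s \<noteq> 0" "ennreal \<bar>s\<bar> = 1" using assms by auto
  then have "lborel = distr lborel borel (\<lambda>t. c + s * t)"
    using lborel_real_affine[of s c] by (simp add: density_1)
  then have "emeasure lborel A = emeasure (distr lborel borel (\<lambda>t. c + s * t)) A"
    by simp
  also have "\<dots> = emeasure lborel ((\<lambda>t. c + s * t) -` A)"
    using assms by (subst emeasure_distr) auto
  finally show ?thesis by simp
qed

text \<open>By uniqueness of the product measure it is enough to compare boxes. The preimage of a
  box is again a box, with permuted, shifted and possibly reflected sides.\<close>

lemma distr_aff:
  assumes \<sigma>: "bij_betw \<sigma> {..<d} {..<d}" and s: "\<And>k. k < d \<Longrightarrow> s k = 1 \<or> s k = (- 1 :: real)"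
  shows "distr (lebP d) (lebP d) (aff d c s \<sigma>) = lebP d"
proof (rule lebP.PiM_eqI)
  fix A :: "nat \<Rightarrow> real set" assume "\<And>i. i \<in> {..<d} \<Longrightarrow> A i \<in> sets lborel"
  then have A: "\<And>i. i < d \<Longrightarrow> A i \<in> sets borel" by simp
  define \<tau> where "\<tau> = inv_into {..<d} \<sigma>"
  have \<tau>: "bij_betw \<tau> {..<d} {..<d}" "\<And>k. k < d \<Longrightarrow> \<tau> (\<sigma> k) = k" "\<And>k. k < d \<Longrightarrow> \<sigma> (\<tau> k) = k"
    using \<sigma> bij_betw_inv_into[OF \<sigma>] by (auto simp: \<tau>_def bij_betw_inv_into_left bij_betw_inv_into_right)
  have lt: "\<And>k. k < d \<Longrightarrow> \<tau> k < d" "\<And>k. k < d \<Longrightarrow> \<sigma> k < d"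
    using \<tau>(1) \<sigma> by (auto simp: bij_betw_def)
  \<comment> \<open>The input coordinate \<open>v j\<close> is read by exactly one output
    coordinate, \<open>\<tau> j\<close>, so \<open>B j\<close> is side \<open>j\<close> of the
    preimage.\<close>
  define B where "B j = (\<lambda>t. c (\<tau> j) + s (\<tau> j) * t) -` A (\<tau> j)" for j
  have B: "B j \<in> sets lborel" if "j < d" for j
  proof -
    have "(\<lambda>t. c (\<tau> j) + s (\<tau> j) * t) -` A (\<tau> j) \<inter> space borel \<in> sets borel"
      using A[OF lt(1)[OF that]] by (intro measurable_sets[of _ _ borel]) auto
    then show ?thesis by (simp add: B_def)
  qed
  have pre: "aff d c s \<sigma> -` PiE {..<d} A \<inter> space (lebP d) = PiE {..<d} B"
  proof (intro set_eqI iffI)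
    fix v assume v: "v \<in> aff d c s \<sigma> -` PiE {..<d} A \<inter> space (lebP d)"
    have "v j \<in> B j" if "j < d" for j
    proof -
      have "aff d c s \<sigma> v (\<tau> j) \<in> A (\<tau> j)" using v lt(1)[OF that] by auto
      then show ?thesis using that lt(1)[OF that] \<tau>(3) by (simp add: aff_def B_def)
    qed
    then show "v \<in> PiE {..<d} B" using v by (auto simp: space_lebP Rd_iff PiE_iff)
  next
    fix v assume v: "v \<in> PiE {..<d} B"
    have "aff d c s \<sigma> v k \<in> A k" if "k < d" for k
    proof -
      have "v (\<sigma> k) \<in> B (\<sigma> k)" using v lt(2)[OF that] by auto
      then show ?thesis using that \<tau>(2) by (simp add: aff_def B_def)
    qed
    then show "v \<in> aff d c s \<sigma> -` PiE {..<d} A \<inter> space (lebP d)"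
      using v aff_in_Rd[of d c s \<sigma> v] by (auto simp: space_lebP Rd_iff PiE_iff)
  qed
  have "emeasure (distr (lebP d) (lebP d) (aff d c s \<sigma>)) (PiE {..<d} A) = emeasure (lebP d) (PiE {..<d} B)"
    unfolding pre[symmetric] using A \<sigma> by (intro emeasure_distr) (auto intro: sets_PiM_I_finite)
  also have "\<dots> = (\<Prod>j<d. emeasure lborel (B j))"
    using B by (intro lebP.emeasure_PiM) auto
  also have "\<dots> = (\<Prod>j<d. emeasure lborel (A (\<tau> j)))"
    unfolding B_def using A lt s by (intro prod.cong emeasure_lborel_affine_vimage) auto
  also have "\<dots> = (\<Prod>i<d. emeasure lborel (A i))"
    by (rule prod.reindex_bij_betw[OF \<tau>(1)])
  finally show "emeasure (distr (lebP d) (lebP d) (aff d c s \<sigma>)) (PiE {..<d} A) = (\<Prod>i<d. emeasure lborel (A i))" .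
qed simp_all

lemma edist_aff:
  assumes \<sigma>: "bij_betw \<sigma> {..<d} {..<d}" and s: "\<And>k. k < d \<Longrightarrow> s k = 1 \<or> s k = (- 1 :: real)"
  shows "edist d (aff d c s \<sigma> v) (aff d c s \<sigma> w) = edist d v w"
proof -
  have "(edist d (aff d c s \<sigma> v) (aff d c s \<sigma> w))\<^sup>2 = (\<Sum>k<d. (v (\<sigma> k) - w (\<sigma> k))\<^sup>2)"
    unfolding edist_sq
  proof (rule sum.cong)
    fix k assume "k \<in> {..<d}"
    then show "(aff d c s \<sigma> v k - aff d c s \<sigma> w k)\<^sup>2 = (v (\<sigma> k) - w (\<sigma> k))\<^sup>2"
      using s[of k] by (auto simp: aff_def power2_commute)
  qed simp
  also have "\<dots> = (\<Sum>k<d. (v k - w k)\<^sup>2)"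
    by (rule sum.reindex_bij_betw[OF \<sigma>])
  finally show ?thesis
    by (simp add: edist_sq[symmetric] power2_eq_iff_nonneg)
qed

lemma indicator_ecball_aff:
  assumes "bij_betw \<sigma> {..<d} {..<d}" "\<And>k. k < d \<Longrightarrow> s k = 1 \<or> s k = (- 1 :: real)"
    and "x \<in> Rd d" "v \<in> Rd d"
  shows "indicator (ecball d (aff d c s \<sigma> x) t) (aff d c s \<sigma> v) = indicator (ecball d x t) v"
  using edist_aff[of \<sigma> d s c x v] assms aff_in_Rd by (simp add: indicator_def)

lemma integral_ecball_aff:
  fixes f :: "(nat \<Rightarrow> real) \<Rightarrow> real"
  assumes \<sigma>: "bij_betw \<sigma> {..<d} {..<d}" and s: "\<And>k. k < d \<Longrightarrow> s k = 1 \<or> s k = (- 1 :: real)"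
    and x: "x \<in> Rd d" and f [measurable]: "f \<in> borel_measurable (lebP d)"
  shows "(LINT v|lebP d. indicator (ecball d (aff d c s \<sigma> x) t) v * f v)
       = (LINT v|lebP d. indicator (ecball d x t) v * f (aff d c s \<sigma> v))"
proof -
  have "(LINT v|lebP d. indicator (ecball d (aff d c s \<sigma> x) t) v * f v)
     = (LINT v|distr (lebP d) (lebP d) (aff d c s \<sigma>). indicator (ecball d (aff d c s \<sigma> x) t) v * f v)"
    by (simp add: distr_aff \<sigma> s)
  also have "\<dots> = (LINT v|lebP d. indicator (ecball d (aff d c s \<sigma> x) t) (aff d c s \<sigma> v) * f (aff d c s \<sigma> v))"
    using \<sigma> by (intro integral_distr) auto
  also have "\<dots> = (LINT v|lebP d. indicator (ecball d x t) v * f (aff d c s \<sigma> v))"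
    by (intro Bochner_Integration.integral_cong) (simp_all add: space_lebP indicator_ecball_aff \<sigma> s x del: Rd.in_mcball)
  finally show ?thesis .
qed

lemma nn_integral_ecball_aff:
  assumes \<sigma>: "bij_betw \<sigma> {..<d} {..<d}" and s: "\<And>k. k < d \<Longrightarrow> s k = 1 \<or> s k = (- 1 :: real)"
    and x: "x \<in> Rd d" and f [measurable]: "f \<in> borel_measurable (lebP d)"
  shows "(\<integral>\<^sup>+v. indicator (ecball d (aff d c s \<sigma> x) t) v * f v \<partial>lebP d)
       = (\<integral>\<^sup>+v. indicator (ecball d x t) v * f (aff d c s \<sigma> v) \<partial>lebP d)"
proof -
  have "(\<integral>\<^sup>+v. indicator (ecball d (aff d c s \<sigma> x) t) v * f v \<partial>lebP d)
     = (\<integral>\<^sup>+v. indicator (ecball d (aff d c s \<sigma> x) t) v * f v \<partial>distr (lebP d) (lebP d) (aff d c s \<sigma>))"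
    by (simp add: distr_aff \<sigma> s)
  also have "\<dots> = (\<integral>\<^sup>+v. indicator (ecball d (aff d c s \<sigma> x) t) (aff d c s \<sigma> v) * f (aff d c s \<sigma> v) \<partial>lebP d)"
    using \<sigma> by (intro nn_integral_distr) auto
  also have "\<dots> = (\<integral>\<^sup>+v. indicator (ecball d x t) v * f (aff d c s \<sigma> v) \<partial>lebP d)"
    by (intro nn_integral_cong) (simp add: space_lebP indicator_ecball_aff \<sigma> s x del: Rd.in_mcball)
  finally show ?thesis .
qed

abbreviation transl :: "nat \<Rightarrow> (nat \<Rightarrow> real) \<Rightarrow> (nat \<Rightarrow> real) \<Rightarrow> nat \<Rightarrow> real" where
  "transl d x \<equiv> aff d x (\<lambda>_. 1) id"

lemma transl_orig: "x \<in> Rd d \<Longrightarrow> transl d x (orig d) = x"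
  by (auto simp: aff_def fun_eq_iff Rd_iff extensional_def)

section \<open>Volumes of balls\<close>

definition vol :: "nat \<Rightarrow> real \<Rightarrow> real" where
  "vol d t = measure (lebP d) (ecball d (orig d) t)"

lemma emeasure_ecball_finite: "emeasure (lebP d) (ecball d x t) < \<infinity>"
proof -
  let ?B = "PiE {..<d} (\<lambda>i. {x i - t .. x i + t})"
  have "ecball d x t \<subseteq> ?B"
  proof
    fix y assume y: "y \<in> ecball d x t"
    then have "x i - t \<le> y i \<and> y i \<le> x i + t" if "i < d" for i
      using component_le_edist[OF that, of x y] by auto
    then show "y \<in> ?B" using y by (auto simp: Rd_iff PiE_iff)
  qed
  moreover have "?B \<in> sets (lebP d)" by (intro sets_PiM_I_finite) auto
  ultimately have "emeasure (lebP d) (ecball d x t) \<le> emeasure (lebP d) ?B"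
    by (rule emeasure_mono)
  also have "\<dots> = (\<Prod>i<d. emeasure lborel {x i - t .. x i + t})"
    by (intro lebP.emeasure_PiM) auto
  also have "\<dots> < \<infinity>" by (auto simp: ennreal_prod_eq_top less_top[symmetric] emeasure_lborel_Icc_eq)
  finally show ?thesis .
qed

lemma emeasure_ecball: 
  assumes "x \<in> Rd d"
  shows "emeasure (lebP d) (ecball d x t) = ennreal (vol d t)"
proof -
  have "emeasure (lebP d) (ecball d x t) = (\<integral>\<^sup>+v. indicator (ecball d (transl d x (orig d)) t) v * 1 \<partial>lebP d)"
    by (simp add: transl_orig assms)
  also have "\<dots> = (\<integral>\<^sup>+v. indicator (ecball d (orig d) t) v * 1 \<partial>lebP d)"
    by (rule nn_integral_ecball_aff) (auto simp: orig_in_Rd)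
  also have "\<dots> = ennreal (vol d t)"
    using emeasure_ecball_finite[of d "orig d" t] by (simp add: vol_def emeasure_eq_ennreal_measure less_top)
  finally show ?thesis .
qed

lemma measure_ecball: "x \<in> Rd d \<Longrightarrow> measure (lebP d) (ecball d x t) = vol d t"
  using emeasure_ecball[of x d t] by (simp add: measure_def vol_def)

text \<open>The cube bounds the volume of the ball and its second moments from below.\<close>

lemma off_centre_cube:
  assumes "x \<in> Rd d" "0 < t"
  obtains Q a where "a > 0" "Q \<in> sets (lebP d)" "Q \<subseteq> ecball d x t" "0 < emeasure (lebP d) Q"
    "\<And>v i. v \<in> Q \<Longrightarrow> i < d \<Longrightarrow> a \<le> v i - x i"
proof
  let ?a = "t / (2 * (real d + 1))"
  let ?Q = "PiE {..<d} (\<lambda>i. {x i + ?a .. x i + 2 * ?a})"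
  show a: "?a > 0" using assms by simp
  show "?Q \<in> sets (lebP d)" by (intro sets_PiM_I_finite) auto
  have "emeasure (lebP d) ?Q = (\<Prod>i<d. emeasure lborel {x i + ?a .. x i + 2 * ?a})"
    by (intro lebP.emeasure_PiM) auto
  also have "\<dots> = (\<Prod>i<d. ennreal ?a)"
  proof (intro prod.cong refl)
    fix i
    have "x i + ?a \<le> x i + 2 * ?a" "(x i + 2 * ?a) - (x i + ?a) = ?a" using a by linarith+
    then show "emeasure lborel {x i + ?a .. x i + 2 * ?a} = ennreal ?a"
      by (simp only: emeasure_lborel_Icc)
  qed
  also have "\<dots> > 0" using a by (simp add: ennreal_power)
  finally show "0 < emeasure (lebP d) ?Q" .
  show "?Q \<subseteq> ecball d x t"
  proof
    fix v assume v: "v \<in> ?Q"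
    have "edist d x v \<le> (\<Sum>i<d. 2 * ?a)"
    proof (intro order_trans[OF edist_le_sum] sum_mono)
      fix i assume "i \<in> {..<d}"
      then have "v i \<in> {x i + ?a .. x i + 2 * ?a}" using v by blast
      then show "\<bar>x i - v i\<bar> \<le> 2 * ?a" using a by (auto simp: abs_le_iff)
    qed
    also have "\<dots> = real d * (t / (real d + 1))" by (simp add: field_simps)
    also have "\<dots> \<le> t" using assms by (simp add: field_simps)
    finally show "v \<in> ecball d x t" using v assms by (auto simp: Rd_iff PiE_iff)
  qed
  show "?a \<le> v i - x i" if "v \<in> ?Q" "i < d" for v i
  proof -
    have "v i \<in> {x i + ?a .. x i + 2 * ?a}" using that by blast
    then show ?thesis by auto
  qed
qed

lemma vol_pos:
  assumes "0 < t" shows "0 < vol d t"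
proof -
  obtain Q where Q: "Q \<in> sets (lebP d)" "Q \<subseteq> ecball d (orig d) t" "0 < emeasure (lebP d) Q"
    using off_centre_cube[OF orig_in_Rd assms] by metis
  have "emeasure (lebP d) Q \<le> ennreal (vol d t)"
    using emeasure_mono[OF Q(2) ecball_sets] emeasure_ecball[OF orig_in_Rd] by metis
  with Q(3) show ?thesis by (metis ennreal_neg leD linorder_not_less order_less_le_trans)
qed

text \<open>A class closed under sums and products on which all ball integrals exist. It contains
  the continuous functions as well as the regularized infimum, which is only lower
  semicontinuous.\<close>

definition loc_bdd :: "nat \<Rightarrow> ((nat \<Rightarrow> real) \<Rightarrow> real) \<Rightarrow> bool" where
  "loc_bdd d f \<longleftrightarrow> f \<in> borel_measurable (lebP d) \<and>
     (\<forall>x\<in>Rd d. \<forall>t. \<exists>C. \<forall>v\<in>ecball d x t. \<bar>f v\<bar> \<le> C)"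

lemma loc_bdd_measurable: "loc_bdd d f \<Longrightarrow> f \<in> borel_measurable (lebP d)"
  by (simp add: loc_bdd_def)

lemma loc_bdd_const: "loc_bdd d (\<lambda>_. c)"
  by (auto simp: loc_bdd_def)

lemma loc_bdd_add: 
  assumes "loc_bdd d f" "loc_bdd d g" shows "loc_bdd d (\<lambda>v. f v + g v)"
proof -
  have "\<exists>C. \<forall>v\<in>ecball d x t. \<bar>f v + g v\<bar> \<le> C" if x: "x \<in> Rd d" for x t
  proof -
    obtain C D where "\<forall>v\<in>ecball d x t. \<bar>f v\<bar> \<le> C" "\<forall>v\<in>ecball d x t. \<bar>g v\<bar> \<le> D"
      using assms x unfolding loc_bdd_def by meson
    then show ?thesis by (intro exI[of _ "C + D"] ballI order_trans[OF abs_triangle_ineq] add_mono) auto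
  qed
  with assms show ?thesis by (auto simp: loc_bdd_def)
qed

lemma loc_bdd_mult: 
  assumes "loc_bdd d f" "loc_bdd d g" shows "loc_bdd d (\<lambda>v. f v * g v)"
proof -
  have "\<exists>C. \<forall>v\<in>ecball d x t. \<bar>f v * g v\<bar> \<le> C" if x: "x \<in> Rd d" for x t
  proof -
    obtain C D where "\<forall>v\<in>ecball d x t. \<bar>f v\<bar> \<le> C" "\<forall>v\<in>ecball d x t. \<bar>g v\<bar> \<le> D"
      using assms x unfolding loc_bdd_def by meson
    then have "\<forall>v\<in>ecball d x t. \<bar>f v * g v\<bar> \<le> C * D"
      unfolding abs_mult by (intro ballI mult_mono) (auto intro: order_trans[OF abs_ge_zero])
    then show ?thesis by blast
  qed
  with assms show ?thesis by (auto simp: loc_bdd_def)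
qed

lemma loc_bdd_cmult: "loc_bdd d f \<Longrightarrow> loc_bdd d (\<lambda>v. c * f v)"
  by (intro loc_bdd_mult loc_bdd_const)

lemma loc_bdd_diff: "loc_bdd d f \<Longrightarrow> loc_bdd d g \<Longrightarrow> loc_bdd d (\<lambda>v. f v - g v)"
  using loc_bdd_add[of d f "\<lambda>v. - 1 * g v"] loc_bdd_cmult[of d g "- 1"] by simp


lemma loc_bdd_continuous:
  assumes "continuous_map (etop d) euclideanreal f" shows "loc_bdd d f"
proof -
  have "\<exists>C. \<forall>v\<in>ecball d x t. \<bar>f v\<bar> \<le> C" for x t
  proof -
    have "compactin euclideanreal (f ` ecball d x t)"
      using image_compactin[OF compactin_ecball assms] .
    then have "bounded (f ` ecball d x t)" by (simp add: compact_imp_bounded)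
    then show ?thesis by (auto simp: bounded_iff)
  qed
  with continuous_map_measurable[OF assms] show ?thesis by (auto simp: loc_bdd_def)
qed

lemma integrable_ecball:
  assumes "loc_bdd d f" "x \<in> Rd d"
  shows "integrable (lebP d) (\<lambda>v. indicator (ecball d x t) v * f v)"
proof -
  obtain C where C: "\<forall>v\<in>ecball d x t. \<bar>f v\<bar> \<le> C" using assms unfolding loc_bdd_def by meson
  have m: "f \<in> borel_measurable (lebP d)" using assms by (simp add: loc_bdd_def)
  have "integrable (lebP d) (\<lambda>v. C * indicator (ecball d x t) v)"
    using emeasure_ecball_finite[of d x t] by (intro integrable_mult_right) (simp add: less_top)
  then show ?thesis
  proof (rule Bochner_Integration.integrable_bound)
    show "AE v in lebP d. norm (indicator (ecball d x t) v * f v) \<le> norm (C * indicator (ecball d x t) v)"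
      using C by (auto simp: indicator_def intro!: AE_I2 order_trans[OF _ abs_ge_self])
  qed (use m in measurable)
qed

text \<open>The real-valued counterpart of \<open>ball_mean\<close>, taken over the uncompleted
  measure so that measurability means Borel measurability; \<open>ball_mean_ge_meanval\<close> links
  the two.\<close>

definition meanval :: "nat \<Rightarrow> (nat \<Rightarrow> real) \<Rightarrow> real \<Rightarrow> ((nat \<Rightarrow> real) \<Rightarrow> real) \<Rightarrow> real" where
  "meanval d x t f = (LINT v|lebP d. indicator (ecball d x t) v * f v) / vol d t"

lemma meanval_add:
  assumes "loc_bdd d f" "loc_bdd d g" "x \<in> Rd d"
  shows "meanval d x t (\<lambda>v. f v + g v) = meanval d x t f + meanval d x t g"
  using integrable_ecball[OF assms(1,3)] integrable_ecball[OF assms(2,3)]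
  by (simp add: meanval_def distrib_left add_divide_distrib)

lemma meanval_cmult: "meanval d x t (\<lambda>v. c * f v) = c * meanval d x t f"
  by (simp add: meanval_def mult.left_commute[of _ c])

lemma meanval_diff:
  assumes "loc_bdd d f" "loc_bdd d g" "x \<in> Rd d"
  shows "meanval d x t (\<lambda>v. f v - g v) = meanval d x t f - meanval d x t g"
  using integrable_ecball[OF assms(1,3)] integrable_ecball[OF assms(2,3)]
  by (simp add: meanval_def right_diff_distrib diff_divide_distrib)

lemma meanval_sum:
  assumes "\<And>i. i \<in> I \<Longrightarrow> loc_bdd d (f i)" "x \<in> Rd d"
  shows "meanval d x t (\<lambda>v. \<Sum>i\<in>I. f i v) = (\<Sum>i\<in>I. meanval d x t (f i))"
  using integrable_ecball[OF assms] by (simp add: meanval_def sum_distrib_left sum_divide_distrib)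

lemma meanval_const:
  assumes "0 < t" "x \<in> Rd d" shows "meanval d x t (\<lambda>_. c) = c"
  using vol_pos[OF assms(1), of d] assms by (simp add: meanval_def measure_ecball mult.commute)

lemma meanval_mono:
  assumes "loc_bdd d f" "loc_bdd d g" "x \<in> Rd d" "0 < t" "\<And>v. v \<in> ecball d x t \<Longrightarrow> f v \<le> g v"
  shows "meanval d x t f \<le> meanval d x t g"
  unfolding meanval_def using vol_pos[OF assms(4), of d] assms(5)
  by (intro divide_right_mono integral_mono integrable_ecball assms(1-3)) (auto simp: indicator_def)

lemma meanval_cong:
  "(\<And>v. v \<in> ecball d x t \<Longrightarrow> f v = g v) \<Longrightarrow> meanval d x t f = meanval d x t g"
  unfolding meanval_def
  by (intro arg_cong2[where f = "(/)"] Bochner_Integration.integral_cong) (auto simp: indicator_def)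

section \<open>Symmetries and second moments of the ball\<close>

lemma meanval_reflect:
  assumes x: "x \<in> Rd d" and i: "i < d" and f: "f \<in> borel_measurable (lebP d)"
  shows "meanval d x t (\<lambda>v. f (v(i := 2 * x i - v i))) = meanval d x t f"
proof -
  let ?T = "aff d (\<lambda>k. if k = i then 2 * x i else 0) (\<lambda>k. if k = i then - 1 else 1) id"
  have T: "?T v = v(i := 2 * x i - v i)" if "v \<in> Rd d" for v
    using that i by (auto simp: aff_def fun_eq_iff Rd_iff extensional_def)
  then have "?T x = x" using x by (simp add: fun_eq_iff)
  then have "(LINT v|lebP d. indicator (ecball d x t) v * f v)
     = (LINT v|lebP d. indicator (ecball d x t) v * f (?T v))"
    using integral_ecball_aff[of id d "\<lambda>k. if k = i then - 1 else 1" x f "\<lambda>k. if k = i then 2 * x i else 0" t] x f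
    by simp
  also have "\<dots> = (LINT v|lebP d. indicator (ecball d x t) v * f (v(i := 2 * x i - v i)))"
    by (intro Bochner_Integration.integral_cong) (auto simp: space_lebP T)
  finally show ?thesis by (simp add: meanval_def)
qed

text \<open>By transposing coordinates, coordinate 0 stands for any other. All second-order errors
  below are expressed as multiples of this number, so its positivity is what matters, not a formula
  for it.\<close>

definition moment :: "nat \<Rightarrow> real \<Rightarrow> real" where
  "moment d t = meanval d (orig d) t (\<lambda>v. (v 0)\<^sup>2)"

lemma loc_bdd_component: "i < d \<Longrightarrow> loc_bdd d (\<lambda>v. v i)"
  by (intro loc_bdd_continuous continuous_map_component)

lemma loc_bdd_component_sq: "i < d \<Longrightarrow> loc_bdd d (\<lambda>v. (v i - c)\<^sup>2)"
  unfolding power2_eq_square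
  by (intro loc_bdd_mult loc_bdd_diff loc_bdd_component loc_bdd_const)

lemma meanval_component_sq:
  assumes x: "x \<in> Rd d" and i: "i < d"
  shows "meanval d x t (\<lambda>v. (v i - x i)\<^sup>2) = moment d t"
proof -
  let ?T = "aff d x (\<lambda>_. 1) (Transposition.transpose 0 i)"
  have b: "bij_betw (Transposition.transpose 0 i) {..<d} {..<d}"
    using i by (simp add: bij_betw_transpose_iff)
  have T0: "?T (orig d) = x" using x i
    by (auto simp: aff_def fun_eq_iff Rd_iff extensional_def Transposition.transpose_def)
  have m: "(\<lambda>v. (v i - x i)\<^sup>2) \<in> borel_measurable (lebP d)"
    using loc_bdd_component_sq[OF i] loc_bdd_measurable by blast
  have "(LINT v|lebP d. indicator (ecball d (?T (orig d)) t) v * (v i - x i)\<^sup>2)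
     = (LINT v|lebP d. indicator (ecball d (orig d) t) v * (?T v i - x i)\<^sup>2)"
    by (rule integral_ecball_aff[OF b _ orig_in_Rd m]) auto
  also have "\<dots> = (LINT v|lebP d. indicator (ecball d (orig d) t) v * (v 0)\<^sup>2)"
    using i by (simp add: aff_def)
  finally show ?thesis by (simp add: T0 meanval_def moment_def)
qed

lemma moment_pos:
  assumes "0 < d" "0 < t"
  shows "0 < moment d t"
proof -
  obtain Q a where a: "a > 0" and Q: "Q \<in> sets (lebP d)" "Q \<subseteq> ecball d (orig d) t" "0 < emeasure (lebP d) Q"
    "\<And>v i. v \<in> Q \<Longrightarrow> i < d \<Longrightarrow> a \<le> v i - orig d i"
    using off_centre_cube[OF orig_in_Rd assms(2)] by metis
  have fin: "emeasure (lebP d) Q < \<infinity>"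
    using emeasure_mono[OF Q(2) ecball_sets] emeasure_ecball_finite order_le_less_trans by blast
  then have "0 < measure (lebP d) Q" using Q(3)
    by (simp add: measure_def enn2real_positive_iff less_top)
  then have "0 < a\<^sup>2 * measure (lebP d) Q" using a by simp
  also have "\<dots> = (LINT v|lebP d. a\<^sup>2 * indicator Q v)" by (simp add: Q)
  also have "\<dots> \<le> (LINT v|lebP d. indicator (ecball d (orig d) t) v * (v 0)\<^sup>2)"
  proof (rule integral_mono)
    show "integrable (lebP d) (\<lambda>v. a\<^sup>2 * indicator Q v)" using Q fin by (simp add: less_top)
    show "integrable (lebP d) (\<lambda>v. indicator (ecball d (orig d) t) v * (v 0)\<^sup>2)"
      using integrable_ecball[OF loc_bdd_component_sq[of 0 d 0] orig_in_Rd] assms by simp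
    fix v show "a\<^sup>2 * indicator Q v \<le> indicator (ecball d (orig d) t) v * (v 0)\<^sup>2"
      using Q(2) Q(4)[of v 0] assms a by (auto simp: indicator_def intro!: power_mono)
  qed
  finally show ?thesis using vol_pos[OF assms(2), of d] by (simp add: moment_def meanval_def)
qed

text \<open>Reflection through the centre turns the mean m into 2 \<open>x i\<close> - m and also
  preserves it.\<close>

lemma meanval_component:
  assumes x: "x \<in> Rd d" and i: "i < d" and t: "0 < t"
  shows "meanval d x t (\<lambda>v. v i) = x i"
proof -
  have "meanval d x t (\<lambda>v. (v(i := 2 * x i - v i)) i) = meanval d x t (\<lambda>v. v i)"
    using meanval_reflect[OF x i, of "\<lambda>v. v i" t] loc_bdd_measurable[OF loc_bdd_component[OF i]] .
  moreover have "meanval d x t (\<lambda>v. 2 * x i - v i) = 2 * x i - meanval d x t (\<lambda>v. v i)"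
    using meanval_diff[OF loc_bdd_const loc_bdd_component[OF i] x] meanval_const[OF t x] by simp
  ultimately show ?thesis by simp
qed

text \<open>The way from the super-mean-value property of \<open>\<psi>\<close> to real integrals.
  Monotonicity of \<open>nn_integral\<close> holds for arbitrary functions, so the positive and the
  negative part of \<open>\<psi>\<close> are compared with those of the measurable minorant
  \<open>f\<close>.\<close>

lemma ball_mean_ge_meanval:
  assumes f: "loc_bdd d f" and x: "x \<in> Rd d" and t: "0 < t"
    and le: "\<And>v. v \<in> ecball d x t \<Longrightarrow> ereal (f v) \<le> \<psi> v"
  shows "ereal (meanval d x t f) \<le> ball_mean d x t \<psi>"
proof -
  let ?B = "ecball d x t" and ?N = "uniform_measure (leb d) (ecball d x t)"
  let ?P = "\<lambda>g. \<integral>\<^sup>+v. ennreal (indicator ?B v * g v) \<partial>lebP d"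
  have fm: "f \<in> borel_measurable (lebP d)" using f by (rule loc_bdd_measurable)
  have Bs: "?B \<in> sets (leb d)" by (simp add: leb_def ecball_sets)
  have eB: "emeasure (leb d) ?B = ennreal (vol d t)"
    by (simp add: leb_def ecball_sets emeasure_ecball x)
  have V: "0 < vol d t" using vol_pos[OF t] .
  have nn: "(\<integral>\<^sup>+v. ennreal (g v) \<partial>?N) = ?P g / ennreal (vol d t)"
    if "g \<in> borel_measurable (lebP d)" for g
  proof -
    have gm: "(\<lambda>v. ennreal (g v)) \<in> borel_measurable (leb d)"
      using that by (simp add: leb_def measurable_completion)
    have "(\<integral>\<^sup>+v. ennreal (g v) \<partial>?N) = (\<integral>\<^sup>+v. ennreal (g v) * indicator ?B v \<partial>leb d) / emeasure (leb d) ?B"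
      using gm Bs by (rule nn_integral_uniform_measure)
    also have "(\<integral>\<^sup>+v. ennreal (g v) * indicator ?B v \<partial>leb d) = ?P g"
      unfolding leb_def nn_integral_completion by (intro nn_integral_cong) (auto simp: indicator_def)
    finally show ?thesis by (simp add: eB)
  qed
  have int: "integrable (lebP d) (\<lambda>v. indicator ?B v * f v)" using integrable_ecball[OF f x] .
  have fin: "?P f < \<infinity>" "?P (\<lambda>v. - f v) < \<infinity>"
    using int unfolding real_integrable_def by (auto simp: less_top)
  define a b where "a = enn2real (?P f)" and "b = enn2real (?P (\<lambda>v. - f v))"
  have ab: "?P f = ennreal a" "?P (\<lambda>v. - f v) = ennreal b" "0 \<le> a" "0 \<le> b"
    using fin by (auto simp: a_def b_def)
  have eq: "meanval d x t f = a / vol d t - b / vol d t"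
    unfolding meanval_def real_lebesgue_integral_def[OF int] a_def b_def
    by (simp add: diff_divide_distrib)
  have AEB: "AE v in ?N. v \<in> ?B" using Bs by (intro AE_uniform_measureI) auto
  have 1: "ennreal (a / vol d t) \<le> (\<integral>\<^sup>+v. e2ennreal (\<psi> v) \<partial>?N)"
  proof -
    have "ennreal (a / vol d t) = (\<integral>\<^sup>+v. ennreal (f v) \<partial>?N)"
      using V ab by (simp add: nn[OF fm] divide_ennreal)
    also have "\<dots> \<le> (\<integral>\<^sup>+v. e2ennreal (\<psi> v) \<partial>?N)"
    proof (rule nn_integral_mono_AE)
      show "AE v in ?N. ennreal (f v) \<le> e2ennreal (\<psi> v)"
        using AEB
      proof eventually_elim
        fix v assume "v \<in> ?B"
        from e2ennreal_mono[OF le[OF this]] show "ennreal (f v) \<le> e2ennreal (\<psi> v)" by simp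
      qed
    qed
    finally show ?thesis .
  qed
  have 2: "(\<integral>\<^sup>+v. e2ennreal (- \<psi> v) \<partial>?N) \<le> ennreal (b / vol d t)"
  proof -
    have "(\<integral>\<^sup>+v. e2ennreal (- \<psi> v) \<partial>?N) \<le> (\<integral>\<^sup>+v. ennreal (- f v) \<partial>?N)"
    proof (rule nn_integral_mono_AE)
      show "AE v in ?N. e2ennreal (- \<psi> v) \<le> ennreal (- f v)"
        using AEB
      proof eventually_elim
        fix v assume "v \<in> ?B"
        from le[OF this] have "- \<psi> v \<le> ereal (- f v)" by (simp flip: uminus_ereal.simps)
        from e2ennreal_mono[OF this] show "e2ennreal (- \<psi> v) \<le> ennreal (- f v)" by simp
      qed
    qed
    also have "\<dots> = ennreal (b / vol d t)"
      using V ab fm by (subst nn) (auto simp: divide_ennreal)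
    finally show ?thesis .
  qed
  have "ereal (meanval d x t f) = enn2ereal (ennreal (a / vol d t)) - enn2ereal (ennreal (b / vol d t))"
    using V ab by (simp add: eq)
  also have "\<dots> \<le> ball_mean d x t \<psi>"
    unfolding ball_mean_def using 1 2 by (intro ereal_minus_mono) (simp_all add: less_eq_ennreal.rep_eq)
  finally show ?thesis .
qed

section \<open>Superharmonicity from the super-mean-value property\<close>

text \<open>Second-order Taylor expansions at \<open>a + h\<close> and \<open>a - h\<close>: the
  first-order terms cancel, and each of the two remainders is within half of the allowed
  error.\<close>

lemma second_difference_approx:
  fixes g g' g'' :: "real \<Rightarrow> real"
  assumes g: "\<And>s. DERIV g s :> g' s" and g': "\<And>s. DERIV g' s :> g'' s"
    and le: "\<And>s. \<bar>s - a\<bar> \<le> \<bar>h\<bar> \<Longrightarrow> \<bar>g'' s - c\<bar> \<le> e"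
  shows "\<bar>g (a + h) + g (a - h) - 2 * g a - c * h\<^sup>2\<bar> \<le> e * h\<^sup>2"
proof (cases "h = 0")
  case False
  define D where "D = (\<lambda>n::nat. if n = 0 then g else if n = 1 then g' else g'')"
  have D: "\<forall>m t. m < 2 \<and> a - \<bar>h\<bar> \<le> t \<and> t \<le> a + \<bar>h\<bar> \<longrightarrow> DERIV (D m) t :> D (Suc m) t"
    using g g' by (auto simp: D_def less_2_cases_iff)
  have *: "\<exists>t. \<bar>t - a\<bar> \<le> \<bar>h\<bar> \<and> g (a + k) = g a + g' a * k + g'' t / 2 * k\<^sup>2" 
    if k: "k \<noteq> 0" "\<bar>k\<bar> = \<bar>h\<bar>" for k
  proof -
    have "\<exists>t. (if a + k < a then a + k < t \<and> t < a else a < t \<and> t < a + k) \<and>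
       g (a + k) = (\<Sum>m<2. (D m a / fact m) * (a + k - a)^m) + (D 2 t / fact 2) * (a + k - a)^2"
      by (rule Taylor[where a = "a - \<bar>h\<bar>" and b = "a + \<bar>h\<bar>", OF _ _ D]) (use k in \<open>auto simp: D_def\<close>)
    then obtain t where t: "if a + k < a then a + k < t \<and> t < a else a < t \<and> t < a + k"
      "g (a + k) = (\<Sum>m<2. (D m a / fact m) * (a + k - a)^m) + (D 2 t / fact 2) * (a + k - a)^2"
      by blast
    from t(1) k have "\<bar>t - a\<bar> \<le> \<bar>h\<bar>" by (auto split: if_splits)
    moreover from t(2) have "g (a + k) = g a + g' a * k + g'' t / 2 * k\<^sup>2"
      by (simp add: D_def numeral_2_eq_2)
    ultimately show ?thesis by blast
  qed
  obtain t where t: "\<bar>t - a\<bar> \<le> \<bar>h\<bar>" "g (a + h) = g a + g' a * h + g'' t / 2 * h\<^sup>2"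
    using *[of h] False by auto
  obtain u where u: "\<bar>u - a\<bar> \<le> \<bar>h\<bar>" "g (a - h) = g a - g' a * h + g'' u / 2 * h\<^sup>2"
    using *[of "- h"] False by auto
  have "g (a + h) + g (a - h) - 2 * g a - c * h\<^sup>2 = ((g'' t - c) + (g'' u - c)) / 2 * h\<^sup>2"
    unfolding t(2) u(2) by (simp add: field_simps)
  also have "\<bar>\<dots>\<bar> \<le> e * h\<^sup>2"
    unfolding abs_mult using le[OF t(1)] le[OF u(1)] by (intro mult_mono) auto
  finally show ?thesis .
qed simp

section \<open>Ball means of smooth functions to second order\<close>

lemma smooth_DERIV:
  assumes "smooth d f" "set is \<subseteq> {..<d}" "w \<in> Rd d" "i < d"
  shows "DERIV (\<lambda>s. fold partial is f (w(i := s))) s :> partial i (fold partial is f) (w(i := s))"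
proof -
  have "w(i := s) \<in> Rd d" using assms fun_upd_in_Rd by blast
  then have "(\<lambda>t. fold partial is f ((w(i := s))(i := t))) differentiable (at ((w(i := s)) i))"
    using assms unfolding smooth_def by blast
  then have "(\<lambda>t. fold partial is f (w(i := t))) differentiable (at s)" by simp
  then show ?thesis by (simp add: partial_def DERIV_deriv_iff_real_differentiable)
qed

lemma continuous_map_into_etop:
  assumes "\<And>v. v \<in> Rd d \<Longrightarrow> T v \<in> Rd d"
    and "\<And>k. k < d \<Longrightarrow> continuous_map (etop d) euclideanreal (\<lambda>v. T v k)"
  shows "continuous_map (etop d) (etop d) T"
proof -
  have "continuous_map (etop d) (product_topology (\<lambda>_. euclideanreal) {..<d}) T"
    unfolding continuous_map_componentwise using assms by (auto simp: Rd_iff)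
  then show ?thesis by (simp add: etop_eq_product_topology)
qed

lemma smooth_continuous: "smooth d f \<Longrightarrow> set is \<subseteq> {..<d} \<Longrightarrow> continuous_map (etop d) euclideanreal (fold partial is f)"
  by (simp add: smooth_def)

text \<open>Passing from the centre to \<open>v\<close> one coordinate at a time and reflecting in the coordinate
  that moves turns every increment into a one-dimensional second difference, so that only the
  unmixed second derivatives occur.\<close>

lemma meanval_smooth:
  assumes \<zeta>: "smooth d \<zeta>" and x: "x \<in> Rd d" and t: "0 < t"
    and le: "\<And>i y. i < d \<Longrightarrow> y \<in> ecball d x t \<Longrightarrow>
      \<bar>partial i (partial i \<zeta>) y - partial i (partial i \<zeta>) x\<bar> \<le> e"
  shows "\<bar>meanval d x t \<zeta> - \<zeta> x - moment d t / 2 * laplacian d \<zeta> x\<bar> \<le> e * real d * moment d t / 2"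
proof -
  define hyb where "hyb i v = (\<lambda>j\<in>{..<d}. if j < i then v j else x j)" for i and v :: "nat \<Rightarrow> real"
  define D where "D i v = \<zeta> (hyb (Suc i) v) - \<zeta> (hyb i v)" for i v
  have hyb_Rd: "hyb i v \<in> Rd d" for i v by (simp add: hyb_def restrict_in_Rd)
  have hyb_cont: "continuous_map (etop d) (etop d) (hyb i)" for i
  proof (rule continuous_map_into_etop[OF hyb_Rd])
    fix k assume "k < d"
    then show "continuous_map (etop d) euclideanreal (\<lambda>v. hyb i v k)"
      by (cases "k < i") (auto simp: hyb_def intro: continuous_map_component)
  qed
  have \<zeta>c: "continuous_map (etop d) euclideanreal \<zeta>" using smooth_continuous[OF \<zeta>, of "[]"] by simp
  have comp: "loc_bdd d (\<lambda>v. \<zeta> (T v))" if "continuous_map (etop d) (etop d) T" for T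
    using continuous_map_compose[OF that \<zeta>c] by (intro loc_bdd_continuous) (simp add: o_def)
  have D_lb: "loc_bdd d (D i)" for i
    unfolding D_def by (intro loc_bdd_diff comp hyb_cont)
  have DR_lb: "loc_bdd d (\<lambda>v. D i (v(i := 2 * x i - v i)))" if i: "i < d" for i
    unfolding D_def
  proof (intro loc_bdd_diff comp)
    have "continuous_map (etop d) (etop d) (\<lambda>v. v(i := 2 * x i - v i))"
    proof (rule continuous_map_into_etop)
      fix k assume "k < d"
      then show "continuous_map (etop d) euclideanreal (\<lambda>v. (v(i := 2 * x i - v i)) k)"
        by (cases "k = i") (auto intro!: continuous_map_diff intro: continuous_map_component)
    qed (use i fun_upd_in_Rd in blast)
    then have R: "continuous_map (etop d) (etop d) (\<lambda>v. hyb k (v(i := 2 * x i - v i)))" for k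
      using continuous_map_compose[OF _ hyb_cont[of k], of "etop d" "\<lambda>v. v(i := 2 * x i - v i)"] by (simp add: o_def)
    show "continuous_map (etop d) (etop d) (\<lambda>v. hyb (Suc i) (v(i := 2 * x i - v i)))"
      "continuous_map (etop d) (etop d) (\<lambda>v. hyb i (v(i := 2 * x i - v i)))" by (rule R)+
  qed
  have mean_D: "\<bar>meanval d x t (D i) - partial i (partial i \<zeta>) x / 2 * moment d t\<bar> \<le> e / 2 * moment d t"
    if i: "i < d" for i
  proof -
    let ?S = "\<lambda>v. D i v + D i (v(i := 2 * x i - v i))" and ?q = "\<lambda>v. (v i - x i)\<^sup>2"
    let ?c = "partial i (partial i \<zeta>) x"
    have lb: "loc_bdd d ?S" by (intro loc_bdd_add D_lb DR_lb i)
    have q: "loc_bdd d ?q" by (rule loc_bdd_component_sq[OF i])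
    have S: "\<bar>?S v - ?c * ?q v\<bar> \<le> e * ?q v" if v: "v \<in> ecball d x t" for v
    proof -
      let ?w = "hyb i v"
      have w: "?w i = x i" using i by (simp add: hyb_def)
      have h1: "hyb (Suc i) v = ?w(i := x i + (v i - x i))"
        "hyb (Suc i) (v(i := 2 * x i - v i)) = ?w(i := x i - (v i - x i))"
        "hyb i (v(i := 2 * x i - v i)) = ?w" "?w = ?w(i := x i)"
        using i by (auto simp: hyb_def fun_eq_iff)
      have "\<bar>\<zeta> (?w(i := x i + (v i - x i))) + \<zeta> (?w(i := x i - (v i - x i))) - 2 * \<zeta> (?w(i := x i)) - ?c * ?q v\<bar> \<le> e * ?q v"
      proof (rule second_difference_approx)
        show "DERIV (\<lambda>s. \<zeta> (?w(i := s))) s :> partial i \<zeta> (?w(i := s))" for s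
          using smooth_DERIV[OF \<zeta>, of "[]" ?w i] i hyb_Rd by simp
        show "DERIV (\<lambda>s. partial i \<zeta> (?w(i := s))) s :> partial i (partial i \<zeta>) (?w(i := s))" for s
          using smooth_DERIV[OF \<zeta>, of "[i]" ?w i] i hyb_Rd by simp
        fix s assume s: "\<bar>s - x i\<bar> \<le> \<bar>v i - x i\<bar>"
        \<comment> \<open>In every coordinate this point is at most as far from \<open>x\<close> as
          \<open>v\<close> is: before \<open>i\<close> it agrees with \<open>v\<close>, after
          \<open>i\<close> with \<open>x\<close>. Hence it lies in the ball where the second
          derivatives are controlled.\<close>
        have "edist d x (?w(i := s)) \<le> edist d x v"
          using s by (intro edist_mono) (auto simp: hyb_def abs_minus_commute)
        then show "\<bar>partial i (partial i \<zeta>) (?w(i := s)) - ?c\<bar> \<le> e"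
          using v i x hyb_Rd by (intro le) (auto intro: fun_upd_in_Rd)
      qed
      then show ?thesis unfolding D_def h1(1-3) using h1(4) by simp
    qed
    have m: "meanval d x t ?S = 2 * meanval d x t (D i)"
      using meanval_add[OF D_lb DR_lb[OF i] x] meanval_reflect[OF x i loc_bdd_measurable[OF D_lb]] by simp
    have q2: "meanval d x t (\<lambda>v. k * ?q v) = k * moment d t" for k
      using meanval_component_sq[OF x i] by (simp add: meanval_cmult)
    have "meanval d x t ?S \<le> meanval d x t (\<lambda>v. (?c + e) * ?q v)"
      using S by (intro meanval_mono lb loc_bdd_cmult q x t) (fastforce simp: algebra_simps abs_le_iff)
    moreover have "meanval d x t (\<lambda>v. (?c - e) * ?q v) \<le> meanval d x t ?S"
      using S by (intro meanval_mono lb loc_bdd_cmult q x t) (fastforce simp: algebra_simps abs_le_iff)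
    ultimately show ?thesis unfolding m q2 abs_le_iff by (simp add: field_simps)
  qed
  have "meanval d x t \<zeta> - \<zeta> x = meanval d x t (\<lambda>v. \<zeta> v - \<zeta> x)"
    using meanval_diff[OF loc_bdd_continuous[OF \<zeta>c] loc_bdd_const x] meanval_const[OF t x] by simp
  also have "\<dots> = meanval d x t (\<lambda>v. \<Sum>i<d. D i v)"
  proof (rule meanval_cong)
    fix v assume v: "v \<in> ecball d x t"
    have "hyb 0 v = x" "hyb d v = v" using v by (auto simp: hyb_def fun_eq_iff Rd_iff extensional_def)
    then show "\<zeta> v - \<zeta> x = (\<Sum>i<d. D i v)"
      unfolding D_def by (subst sum_lessThan_telescope) simp
  qed
  also have "\<dots> = (\<Sum>i<d. meanval d x t (D i))"
    by (rule meanval_sum[OF D_lb x])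
  finally have "meanval d x t \<zeta> - \<zeta> x - moment d t / 2 * laplacian d \<zeta> x
     = (\<Sum>i<d. meanval d x t (D i) - partial i (partial i \<zeta>) x / 2 * moment d t)"
    by (simp add: laplacian_def sum_subtractf sum_distrib_left mult.commute)
  also have "\<bar>\<dots>\<bar> \<le> (\<Sum>i<d. e / 2 * moment d t)"
    using mean_D by (intro order_trans[OF sum_abs] sum_mono) auto
  finally show ?thesis by (simp add: algebra_simps)
qed

text \<open>The point \<open>y\<close> may leave the compact ball, so the cover consists of open
  sets of the whole space on which \<open>f\<close> oscillates by at most \<open>e\<close>. A
  Lebesgue number of this cover, halved to pass to closed balls, is the required radius.\<close>

lemma uniformly_close_on_ecball:
  assumes f: "continuous_map (etop d) euclideanreal f" and e: "0 < e"
  shows "\<exists>\<delta>>0. \<forall>x\<in>ecball d a R. \<forall>y\<in>ecball d x \<delta>. \<bar>f y - f x\<bar> \<le> e"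
proof -
  let ?C = "{U. openin (etop d) U \<and> (\<forall>x\<in>U. \<forall>y\<in>U. \<bar>f y - f x\<bar> \<le> e)}"
  have "ecball d a R \<subseteq> \<Union>?C"
  proof
    fix x assume x: "x \<in> ecball d a R"
    let ?U = "{y \<in> topspace (etop d). f y \<in> ball (f x) (e / 2)}"
    have "openin (etop d) ?U" using f by (rule openin_continuous_map_preimage) simp
    moreover have "\<bar>f z - f y\<bar> \<le> e" if "y \<in> ?U" "z \<in> ?U" for y z
      using that by (simp add: dist_real_def abs_if split: if_splits)
    ultimately have "?U \<in> ?C" by blast
    moreover have "x \<in> ?U" using x e by simp
    ultimately show "x \<in> \<Union>?C" by blast
  qed
  then obtain \<epsilon> where \<epsilon>: "\<epsilon> > 0" "\<forall>x\<in>ecball d a R. \<exists>U\<in>?C. eball d x \<epsilon> \<subseteq> U"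
    using Rd.lebesgue_number[OF compactin_ecball, of d a R ?C] by (metis (no_types, lifting) mem_Collect_eq)
  have "\<bar>f y - f x\<bar> \<le> e" if x: "x \<in> ecball d a R" and y: "y \<in> ecball d x (\<epsilon> / 2)" for x y
  proof -
    obtain U where U: "U \<in> ?C" "eball d x \<epsilon> \<subseteq> U" using \<epsilon>(2) x by blast
    have "x \<in> eball d x \<epsilon>" "y \<in> eball d x \<epsilon>" using \<epsilon>(1) x y by auto
    then show ?thesis using U by blast
  qed
  then show ?thesis using \<epsilon>(1) by (intro exI[of _ "\<epsilon> / 2"]) auto
qed

text \<open>Averaging over balls of a fixed radius is self-adjoint: Tonelli, together with the
  symmetry of the relation \<open>edist d x y \<le> t\<close>. This moves the mean from the test
  function to the superharmonic candidate.\<close>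

lemma nn_integral_ecball_swap:
  assumes f [measurable]: "f \<in> borel_measurable (lebP d)" and g [measurable]: "g \<in> borel_measurable (lebP d)"
  shows "(\<integral>\<^sup>+y. f y * (\<integral>\<^sup>+x. indicator (ecball d y t) x * g x \<partial>lebP d) \<partial>lebP d)
       = (\<integral>\<^sup>+x. g x * (\<integral>\<^sup>+y. indicator (ecball d x t) y * f y \<partial>lebP d) \<partial>lebP d)"
proof -
  interpret pair_sigma_finite "lebP d" "lebP d"
    using sigma_finite_lebP by (simp add: pair_sigma_finite_def)
  let ?F = "\<lambda>(y, x). f y * g x * indicator {p. edist d (fst p) (snd p) \<le> t} (y, x) :: ennreal"
  have comp: "(\<lambda>p. fst p i) \<in> borel_measurable (lebP d \<Otimes>\<^sub>M lebP d)"
    "(\<lambda>p. snd p i) \<in> borel_measurable (lebP d \<Otimes>\<^sub>M lebP d)" if "i < d" for i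
    using continuous_map_measurable[OF continuous_map_component[OF that]]
    by (auto intro: measurable_compose[OF measurable_fst] measurable_compose[OF measurable_snd])
  have [measurable]: "(\<lambda>p. edist d (fst p) (snd p)) \<in> borel_measurable (lebP d \<Otimes>\<^sub>M lebP d)"
    unfolding edist_def L2_set_def using comp by (intro measurable_compose[OF _ borel_measurable_sqrt]
      borel_measurable_sum borel_measurable_power borel_measurable_diff) auto
  have F: "?F \<in> borel_measurable (lebP d \<Otimes>\<^sub>M lebP d)"
  proof -
    have "(\<lambda>p. f (fst p) * g (snd p) * (if edist d (fst p) (snd p) \<le> t then 1 else 0)) \<in> borel_measurable (lebP d \<Otimes>\<^sub>M lebP d)"
      by (intro borel_measurable_times_ennreal measurable_If measurable_compose[OF measurable_fst f]
          measurable_compose[OF measurable_snd g]) auto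
    moreover have "?F = (\<lambda>p. f (fst p) * g (snd p) * (if edist d (fst p) (snd p) \<le> t then 1 else 0))"
      by (auto simp: indicator_def fun_eq_iff)
    ultimately show ?thesis by simp
  qed
  have "(\<integral>\<^sup>+y. f y * (\<integral>\<^sup>+x. indicator (ecball d y t) x * g x \<partial>lebP d) \<partial>lebP d)
     = (\<integral>\<^sup>+y. (\<integral>\<^sup>+x. ?F (y, x) \<partial>lebP d) \<partial>lebP d)"
  proof (rule nn_integral_cong)
    fix y assume y: "y \<in> space (lebP d)"
    have "f y * (\<integral>\<^sup>+x. indicator (ecball d y t) x * g x \<partial>lebP d)
       = (\<integral>\<^sup>+x. f y * (indicator (ecball d y t) x * g x) \<partial>lebP d)"
      by (rule nn_integral_cmult[symmetric]) (use g in measurable)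
    also have "\<dots> = (\<integral>\<^sup>+x. ?F (y, x) \<partial>lebP d)"
      using y by (intro nn_integral_cong) (auto simp: indicator_def space_lebP)
    finally show "f y * (\<integral>\<^sup>+x. indicator (ecball d y t) x * g x \<partial>lebP d) = (\<integral>\<^sup>+x. ?F (y, x) \<partial>lebP d)" .
  qed
  also have "\<dots> = (\<integral>\<^sup>+x. (\<integral>\<^sup>+y. ?F (y, x) \<partial>lebP d) \<partial>lebP d)"
    using Fubini'[OF F] by simp
  also have "\<dots> = (\<integral>\<^sup>+x. g x * (\<integral>\<^sup>+y. indicator (ecball d x t) y * f y \<partial>lebP d) \<partial>lebP d)"
  proof (rule nn_integral_cong)
    fix x assume x: "x \<in> space (lebP d)"
    have "g x * (\<integral>\<^sup>+y. indicator (ecball d x t) y * f y \<partial>lebP d)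
       = (\<integral>\<^sup>+y. g x * (indicator (ecball d x t) y * f y) \<partial>lebP d)"
      by (rule nn_integral_cmult[symmetric]) (use f in measurable)
    also have "\<dots> = (\<integral>\<^sup>+y. ?F (y, x) \<partial>lebP d)"
      using x by (intro nn_integral_cong) (auto simp: indicator_def space_lebP edist_commute mult.commute)
    finally show "(\<integral>\<^sup>+y. ?F (y, x) \<partial>lebP d) = g x * (\<integral>\<^sup>+y. indicator (ecball d x t) y * f y \<partial>lebP d)" by simp
  qed
  finally show ?thesis .
qed

section \<open>Passage to the distributional inequality\<close>

lemma nn_integral_ecball_eq_meanval:
  assumes "loc_bdd d f" "x \<in> Rd d" "0 < t" "\<And>v. 0 \<le> f v"
  shows "(\<integral>\<^sup>+v. indicator (ecball d x t) v * ennreal (f v) \<partial>lebP d) = ennreal (vol d t * meanval d x t f)"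
proof -
  have "(\<integral>\<^sup>+v. indicator (ecball d x t) v * ennreal (f v) \<partial>lebP d)
     = (\<integral>\<^sup>+v. ennreal (indicator (ecball d x t) v * f v) \<partial>lebP d)"
    by (intro nn_integral_cong) (auto simp: indicator_def)
  also have "\<dots> = ennreal (LINT v|lebP d. indicator (ecball d x t) v * f v)"
    using assms by (intro nn_integral_eq_integral integrable_ecball) auto
  finally show ?thesis using vol_pos[OF assms(3), of d] by (simp add: meanval_def)
qed

text \<open>The complement of the support is open, so a function vanishing on it vanishes along
  short coordinate segments through each of its points, and its partial derivatives vanish there as
  well. This is applied twice.\<close>

lemma test_function_zero:
  assumes "test_function d \<Omega> \<zeta>" and x: "x \<in> Rd d - etop d closure_of {x \<in> Rd d. \<zeta> x \<noteq> 0}"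
  shows "\<zeta> x = 0" "laplacian d \<zeta> x = 0"
proof -
  let ?K = "etop d closure_of {x \<in> Rd d. \<zeta> x \<noteq> 0}"
  have sub: "{x \<in> Rd d. \<zeta> x \<noteq> 0} \<subseteq> ?K" by (rule closure_of_subset) auto
  have ev: "\<forall>\<^sub>F s in nhds (y i). y(i := s) \<in> Rd d - ?K" if y: "y \<in> Rd d - ?K" and i: "i < d" for y i
  proof -
    have "openin (etop d) (Rd d - ?K)" by (metis closedin_closure_of closedin_def Rd.topspace_mtopology)
    then obtain r where r: "r > 0" "eball d y r \<subseteq> Rd d - ?K"
      using y unfolding Rd.openin_mtopology by blast
    have "y(i := s) \<in> Rd d - ?K" if s: "dist s (y i) < r" for s
    proof -
      have "edist d y (y(i := s)) \<le> (\<Sum>j<d. if j = i then \<bar>y i - s\<bar> else 0)"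
        by (rule order_trans[OF edist_le_sum]) (rule sum_mono, auto)
      also have "\<dots> < r" using i s by (simp add: dist_real_def abs_minus_commute)
      finally have "y(i := s) \<in> eball d y r" using y i fun_upd_in_Rd by simp
      then show ?thesis using r(2) by blast
    qed
    then show ?thesis unfolding eventually_nhds_metric using r(1) by blast
  qed
  have step: "partial i f y = 0" if f: "\<And>y. y \<in> Rd d - ?K \<Longrightarrow> f y = 0" and y: "y \<in> Rd d - ?K" and i: "i < d" for f i y
  proof -
    have "\<forall>\<^sub>F s in nhds (y i). f (y(i := s)) = 0"
      using ev[OF y i] by eventually_elim (rule f)
    then have "deriv (\<lambda>s. f (y(i := s))) (y i) = deriv (\<lambda>s. 0) (y i)"
      by (intro deriv_cong_ev) auto
    then show ?thesis by (simp add: partial_def)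
  qed
  have z: "\<zeta> x = 0" if "x \<in> Rd d - ?K" for x using sub that by auto
  then show "\<zeta> x = 0" using x .
  have "partial i (partial i \<zeta>) x = 0" if "i < d" for i
    by (rule step[OF step[OF z] x]) (use that in auto)
  then show "laplacian d \<zeta> x = 0" by (simp add: laplacian_def)
qed

text \<open>Write m for the second moment and A_t for the averaging operator. Self-adjointness gives
  \<integral> \<phi> A_t \<zeta> = \<integral> \<zeta> A_t \<phi> \<le> \<integral> \<zeta> \<phi>,
  while A_t \<zeta> is \<zeta> + (m / 2) \<Delta>\<zeta> up to o(m) uniformly. Dividing by m / 2 and
  letting t tend to 0 leaves \<integral> \<phi> \<Delta>\<zeta> \<le> 0.\<close>

lemma superharmonic_of_super_mean:
  assumes d: "0 < d" and \<phi>: "loc_bdd d \<phi>" and nn: "\<And>x. 0 \<le> \<phi> x"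
    and mean: "\<And>K. compactin (etop d) K \<Longrightarrow> K \<subseteq> \<Omega> \<Longrightarrow>
      \<exists>\<delta>>0. \<forall>y\<in>K. \<forall>t. 0 < t \<and> t \<le> \<delta> \<longrightarrow> meanval d y t \<phi> \<le> \<phi> y"
  shows "superharmonic d \<Omega> \<phi>"
  unfolding superharmonic_def
proof (intro conjI allI impI)
  have \<phi>m [measurable]: "\<phi> \<in> borel_measurable (lebP d)" using \<phi> by (rule loc_bdd_measurable)
  have bdd: "\<exists>R. K \<subseteq> ecball d (orig d) R" if K: "compactin (etop d) K" for K
  proof (cases "K = {}")
    case False
    then obtain x where x: "x \<in> K" by blast
    obtain B where "K \<subseteq> Rd d" "\<forall>x\<in>K. \<forall>y\<in>K. edist d x y \<le> B"
      using Rd.compactin_imp_mbounded[OF K] by (auto simp: Rd.mbounded_alt_pos)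
    then have "K \<subseteq> ecball d (orig d) (edist d (orig d) x + B)"
      using x orig_in_Rd by (auto intro!: order_trans[OF edist_triangle[of d "orig d" _ x]])
    then show ?thesis by blast
  qed simp
  show "locally_integrable d \<Omega> \<phi>"
    unfolding locally_integrable_def
  proof (intro allI impI)
    fix K assume K: "compactin (etop d) K \<and> K \<subseteq> \<Omega>"
    obtain R where R: "K \<subseteq> ecball d (orig d) R" using bdd K by blast
    have Ks: "K \<in> sets (lebP d)"
      using K compactin_imp_closedin[OF Rd.Hausdorff_space_mtopology] by (intro closedin_sets_lebP) auto
    have "integrable (lebP d) (\<lambda>x. indicator K x * \<phi> x)"
    proof (rule Bochner_Integration.integrable_bound[OF integrable_ecball[OF \<phi> orig_in_Rd]])
      show "AE x in lebP d. norm (indicator K x * \<phi> x) \<le> norm (indicator (ecball d (orig d) R) x * \<phi> x)"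
        using R by (intro AE_I2) (auto simp: indicator_def)
    qed (use Ks in measurable)
    then show "set_integrable (leb d) K \<phi>"
      unfolding set_integrable_def leb_def using Ks by (subst integrable_completion) auto
  qed
  fix \<zeta> assume "test_function d \<Omega> \<zeta> \<and> (\<forall>x\<in>Rd d. 0 \<le> \<zeta> x)"
  then have test: "test_function d \<Omega> \<zeta>" and \<zeta>0: "\<And>x. x \<in> Rd d \<Longrightarrow> 0 \<le> \<zeta> x" by auto
  let ?K = "etop d closure_of {x \<in> Rd d. \<zeta> x \<noteq> 0}" and ?L = "laplacian d \<zeta>"
  have sm: "smooth d \<zeta>" and Kc: "compactin (etop d) ?K" and KO: "?K \<subseteq> \<Omega>"
    using test by (auto simp: test_function_def)
  note zero = test_function_zero[OF test]
  have \<zeta>c: "continuous_map (etop d) euclideanreal \<zeta>" using smooth_continuous[OF sm, of "[]"] by simp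
  have pc: "continuous_map (etop d) euclideanreal (partial i (partial i \<zeta>))" if "i < d" for i
    using smooth_continuous[OF sm, of "[i, i]"] that by simp
  have Lc: "continuous_map (etop d) euclideanreal ?L"
    unfolding laplacian_def by (intro continuous_map_sum pc) auto
  have Lm [measurable]: "?L \<in> borel_measurable (lebP d)" and \<zeta>m [measurable]: "\<zeta> \<in> borel_measurable (lebP d)"
    using Lc \<zeta>c by (auto intro: continuous_map_measurable)
  obtain R where R: "?K \<subseteq> ecball d (orig d) R" using bdd Kc by blast
  \<comment> \<open>Radii will be at most 1, so balls centred outside \<open>?Q\<close> miss the
    support of \<open>\<zeta>\<close> and the expansion error has to be paid on \<open>?Q\<close>
    only.\<close>
  let ?Q = "ecball d (orig d) (R + 1)"
  have KQ: "?K \<subseteq> ?Q" using R by fastforce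
  define A where "A = (LINT v|lebP d. indicator ?Q v * \<phi> v)"
  define I where "I = (LINT v|lebP d. \<phi> v * ?L v)"
  define J where "J = (LINT v|lebP d. \<phi> v * \<zeta> v)"
  have A0: "0 \<le> A" unfolding A_def using nn by (intro integral_nonneg_AE) auto
  have supp: "integrable (lebP d) (\<lambda>v. \<phi> v * f v)" 
    if "continuous_map (etop d) euclideanreal f" "\<And>x. x \<in> Rd d - ?K \<Longrightarrow> f x = 0" for f
  proof -
    have "integrable (lebP d) (\<lambda>v. indicator ?Q v * (\<phi> v * f v))"
      by (intro integrable_ecball loc_bdd_mult \<phi> loc_bdd_continuous that orig_in_Rd)
    moreover have "indicator ?Q v * (\<phi> v * f v) = \<phi> v * f v" if "v \<in> space (lebP d)" for v
      using that \<open>\<And>x. x \<in> Rd d - ?K \<Longrightarrow> f x = 0\<close>[of v] KQ by (cases "v \<in> ?K") (auto simp: space_lebP indicator_def)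
    ultimately show ?thesis by (simp cong: Bochner_Integration.integrable_cong)
  qed
  have iL: "integrable (lebP d) (\<lambda>v. \<phi> v * ?L v)" using supp[OF Lc] zero by blast
  have i\<zeta>: "integrable (lebP d) (\<lambda>v. \<phi> v * \<zeta> v)" using supp[OF \<zeta>c] zero by blast
  have iQ: "integrable (lebP d) (\<lambda>v. indicator ?Q v * \<phi> v)" by (rule integrable_ecball[OF \<phi> orig_in_Rd])
  have LINT_eq: "(LINT x:\<Omega>|leb d. \<phi> x * ?L x) = I"
  proof -
    have "(LINT x:\<Omega>|leb d. \<phi> x * ?L x) = (LINT x|leb d. \<phi> x * ?L x)"
      unfolding set_lebesgue_integral_def
    proof (rule Bochner_Integration.integral_cong)
      fix x assume "x \<in> space (leb d)"
      then show "indicator \<Omega> x *\<^sub>R (\<phi> x * ?L x) = \<phi> x * ?L x"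
        using zero(2)[of x] KO by (cases "x \<in> ?K") (auto simp: space_leb indicator_def)
    qed simp
    then show ?thesis unfolding I_def leb_def by (simp add: integral_completion)
  qed
  obtain \<delta>0 where \<delta>0: "\<delta>0 > 0" "\<And>y t. y \<in> ?K \<Longrightarrow> 0 < t \<Longrightarrow> t \<le> \<delta>0 \<Longrightarrow> meanval d y t \<phi> \<le> \<phi> y"
    using mean[OF Kc KO] by blast
  \<comment> \<open>If the second derivatives oscillate by at most \<open>e\<close>, the total error
    is \<open>e * real d * moment d t / 2\<close> times \<open>A\<close>. Division by
    \<open>moment d t / 2\<close> removes the radius \<open>t\<close> from the bound.\<close>
  have main: "I \<le> e * real d * A" if e: "e > 0" for e
  proof -
    have "\<forall>i. \<exists>\<delta>>0. i < d \<longrightarrow> (\<forall>x\<in>?Q. \<forall>y\<in>ecball d x \<delta>. \<bar>partial i (partial i \<zeta>) y - partial i (partial i \<zeta>) x\<bar> \<le> e)"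
      using uniformly_close_on_ecball[OF pc e] zero_less_one by blast
    then obtain \<delta> where \<delta>: "\<And>i. \<delta> i > 0" "\<And>i x y. i < d \<Longrightarrow> x \<in> ?Q \<Longrightarrow> y \<in> ecball d x (\<delta> i) \<Longrightarrow>
        \<bar>partial i (partial i \<zeta>) y - partial i (partial i \<zeta>) x\<bar> \<le> e" by metis
    define t where "t = Min (insert (min 1 \<delta>0) (\<delta> ` {..<d}))"
    have t: "0 < t" "t \<le> 1" "t \<le> \<delta>0" "\<And>i. i < d \<Longrightarrow> t \<le> \<delta> i"
      using \<delta>(1) \<delta>0(1) by (auto simp: t_def Min_le_iff)
    let ?m = "moment d t" and ?V = "vol d t"
    have V: "0 < ?V" and m: "0 < ?m" using vol_pos moment_pos d t by auto
    define c where "c = e * real d * ?m / 2"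
    have pt: "\<zeta> x + ?m / 2 * ?L x - c * indicator ?Q x \<le> meanval d x t \<zeta>" if x: "x \<in> Rd d" for x
    proof (cases "x \<in> ?Q")
      case True
      have "\<bar>meanval d x t \<zeta> - \<zeta> x - ?m / 2 * ?L x\<bar> \<le> c"
        unfolding c_def
      proof (rule meanval_smooth[OF sm x t(1)])
        fix i y assume i: "i < d" and "y \<in> ecball d x t"
        then have "y \<in> ecball d x (\<delta> i)" using t(4)[OF i] by auto
        then show "\<bar>partial i (partial i \<zeta>) y - partial i (partial i \<zeta>) x\<bar> \<le> e" using \<delta>(2) i True by blast
      qed
      then show ?thesis using True by (simp add: abs_le_iff)
    next
      case False
      have "meanval d x t \<zeta> = meanval d x t (\<lambda>_. 0)"
      proof (rule meanval_cong)
        fix v assume v: "v \<in> ecball d x t"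
        have "v \<notin> ?K"
        proof
          assume "v \<in> ?K"
          then have "edist d (orig d) v \<le> R" using R by auto
          then have "edist d (orig d) x \<le> R + 1"
            using edist_triangle[of d "orig d" x v] v t(2) by (auto simp: edist_commute)
          then show False using False x orig_in_Rd by auto
        qed
        then show "\<zeta> v = 0" using zero(1) v by auto
      qed
      moreover have "x \<notin> ?K" using False KQ by auto
      ultimately show ?thesis using zero x False by (simp add: meanval_const t)
    qed
    define h where "h v = \<phi> v * (\<zeta> v + ?m / 2 * ?L v - c * indicator ?Q v)" for v
    have h: "h = (\<lambda>v. \<phi> v * \<zeta> v + ?m / 2 * (\<phi> v * ?L v) - c * (indicator ?Q v * \<phi> v))"
      by (auto simp: h_def fun_eq_iff algebra_simps)
    have ih: "integrable (lebP d) h"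
      unfolding h by (intro Bochner_Integration.integrable_diff Bochner_Integration.integrable_add integrable_mult_right iL i\<zeta> iQ)
    have Ih: "integral\<^sup>L (lebP d) h = J + ?m / 2 * I - c * A"
      unfolding h J_def I_def A_def using iL i\<zeta> iQ by simp
    \<comment> \<open>\<open>\<zeta>\<close> may be negative off \<open>Rd d\<close>\<close>
    define \<zeta>' where "\<zeta>' v = max 0 (\<zeta> v)" for v
    have \<zeta>': "\<zeta>' v = \<zeta> v" if "v \<in> Rd d" for v using \<zeta>0[OF that] by (simp add: \<zeta>'_def)
    have \<zeta>'0: "0 \<le> \<zeta>' v" for v by (simp add: \<zeta>'_def)
    have \<zeta>'c: "continuous_map (etop d) euclideanreal \<zeta>'"
      unfolding \<zeta>'_def by (intro continuous_map_real_max \<zeta>c) auto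
    have mz: "meanval d x t \<zeta>' = meanval d x t \<zeta>" for x
      by (rule meanval_cong) (simp add: \<zeta>')
    \<comment> \<open>Working in \<open>ennreal\<close> gives Tonelli without integrability on the
      product. The truncation of \<open>h\<close> at 0 does no harm, since the integral of
      \<open>h\<close> is at most that of its positive part.\<close>
    have "ennreal ?V * (\<integral>\<^sup>+v. ennreal (h v) \<partial>lebP d) = (\<integral>\<^sup>+v. ennreal ?V * ennreal (h v) \<partial>lebP d)"
      using ih by (intro nn_integral_cmult[symmetric]) auto
    also have "\<dots> \<le> (\<integral>\<^sup>+x. ennreal (\<phi> x) * (\<integral>\<^sup>+y. indicator (ecball d x t) y * ennreal (\<zeta>' y) \<partial>lebP d) \<partial>lebP d)"
    proof (rule nn_integral_mono)
      fix x assume "x \<in> space (lebP d)"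
      then have x: "x \<in> Rd d" by (simp add: space_lebP)
      have "?V * h x \<le> \<phi> x * (?V * meanval d x t \<zeta>)"
        using mult_left_mono[OF pt[OF x], of "?V * \<phi> x"] V nn[of x] by (simp add: h_def algebra_simps)
      then have "ennreal (?V * h x) \<le> ennreal (\<phi> x * (?V * meanval d x t \<zeta>))" by (rule ennreal_leI)
      also have "\<dots> = ennreal (\<phi> x) * (\<integral>\<^sup>+y. indicator (ecball d x t) y * ennreal (\<zeta>' y) \<partial>lebP d)"
        using nn by (subst nn_integral_ecball_eq_meanval[OF loc_bdd_continuous[OF \<zeta>'c] x t(1)])
          (auto simp: \<zeta>'0 ennreal_mult' mz)
      finally show "ennreal ?V * ennreal (h x) \<le> ennreal (\<phi> x) * (\<integral>\<^sup>+y. indicator (ecball d x t) y * ennreal (\<zeta>' y) \<partial>lebP d)"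
        using V by (simp add: ennreal_mult')
    qed
    also have "\<dots> = (\<integral>\<^sup>+y. ennreal (\<zeta>' y) * (\<integral>\<^sup>+x. indicator (ecball d y t) x * ennreal (\<phi> x) \<partial>lebP d) \<partial>lebP d)"
      using continuous_map_measurable[OF \<zeta>'c] by (intro nn_integral_ecball_swap) auto
    also have "\<dots> \<le> (\<integral>\<^sup>+y. ennreal ?V * ennreal (\<phi> y * \<zeta> y) \<partial>lebP d)"
    proof (rule nn_integral_mono)
      fix y assume "y \<in> space (lebP d)"
      then have y: "y \<in> Rd d" by (simp add: space_lebP)
      have eq: "ennreal (\<zeta>' y) * (\<integral>\<^sup>+x. indicator (ecball d y t) x * ennreal (\<phi> x) \<partial>lebP d) = ennreal (\<zeta> y * (?V * meanval d y t \<phi>))"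
        using \<zeta>0[OF y] nn by (subst nn_integral_ecball_eq_meanval[OF \<phi> y t(1)]) (auto simp: \<zeta>' y ennreal_mult')
      have "\<zeta> y * (?V * meanval d y t \<phi>) \<le> ?V * (\<phi> y * \<zeta> y)"
      proof (cases "y \<in> ?K")
        case True
        then show ?thesis using mult_left_mono[OF \<delta>0(2)[OF True t(1,3)], of "\<zeta> y * ?V"] \<zeta>0[OF y] V
          by (simp add: mult_ac)
      qed (use zero(1) y in simp)
      then show "ennreal (\<zeta>' y) * (\<integral>\<^sup>+x. indicator (ecball d y t) x * ennreal (\<phi> x) \<partial>lebP d) \<le> ennreal ?V * ennreal (\<phi> y * \<zeta> y)"
        unfolding eq using V by (subst ennreal_mult'[symmetric]) (auto intro: ennreal_leI)
    qed
    also have "\<dots> = ennreal ?V * (\<integral>\<^sup>+y. ennreal (\<phi> y * \<zeta> y) \<partial>lebP d)"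
      by (rule nn_integral_cmult) measurable
    also have "(\<integral>\<^sup>+y. ennreal (\<phi> y * \<zeta> y) \<partial>lebP d) = ennreal J"
      unfolding J_def using i\<zeta> \<zeta>0 nn by (intro nn_integral_eq_integral AE_I2) (auto simp: space_lebP)
    finally have "(\<integral>\<^sup>+v. ennreal (h v) \<partial>lebP d) \<le> ennreal J"
      using V by (simp add: ennreal_mult_le_mult_iff)
    moreover have "0 \<le> J" unfolding J_def using \<zeta>0 nn by (intro integral_nonneg_AE AE_I2) (auto simp: space_lebP)
    ultimately have "enn2real (\<integral>\<^sup>+v. ennreal (h v) \<partial>lebP d) \<le> J" by (rule enn2real_leI[rotated])
    moreover have "integral\<^sup>L (lebP d) h \<le> enn2real (\<integral>\<^sup>+v. ennreal (h v) \<partial>lebP d)"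
      unfolding real_lebesgue_integral_def[OF ih] by simp
    ultimately have "?m / 2 * I \<le> c * A" using Ih by linarith
    then have "?m / 2 * I \<le> ?m / 2 * (e * real d * A)" by (simp add: c_def mult_ac)
    then show ?thesis using m by (simp only: mult_le_cancel_left_pos half_gt_zero)
  qed
  have "I \<le> 0"
  proof (rule field_le_epsilon)
    fix e :: real assume e: "0 < e"
    \<comment> \<open>The mass \<open>A\<close> may be 0, hence the \<open>+ 1\<close> in the
      denominator.\<close>
    have pos: "0 < real d * A + 1" using A0 by (simp add: add_nonneg_pos)
    have "I \<le> e / (real d * A + 1) * real d * A" using main[of "e / (real d * A + 1)"] e pos by simp
    also have "\<dots> = e * ((real d * A) / (real d * A + 1))" by simp
    also have "\<dots> \<le> e * 1" using e pos by (intro mult_left_mono) auto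
    finally show "I \<le> 0 + e" by simp
  qed
  then show "(LINT x:\<Omega>|leb d. \<phi> x * ?L x) \<le> 0" by (simp only: LINT_eq)
qed

section \<open>The minimum principle and bounds for the upper class\<close>

text \<open>Squared distance has strictly larger means than values at the centre. It is the
  perturbation that produces strict inequalities in the minimum principle.\<close>

lemma meanval_edist_sq:
  assumes x: "x \<in> Rd d" and t: "0 < t"
  shows "meanval d x t (\<lambda>v. (edist d v p)\<^sup>2) = (edist d x p)\<^sup>2 + real d * moment d t"
proof -
  have "meanval d x t (\<lambda>v. (v i - p i)\<^sup>2) = moment d t + (x i - p i)\<^sup>2" if i: "i < d" for i
  proof -
    have "(\<lambda>v. (v i - p i)\<^sup>2) = (\<lambda>v. ((v i - x i)\<^sup>2 + 2 * (x i - p i) * v i) + ((x i - p i)\<^sup>2 - 2 * (x i - p i) * x i))"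
      by (auto simp: fun_eq_iff power2_eq_square algebra_simps)
    then show ?thesis
      using i x t
      by (simp add: meanval_add loc_bdd_add loc_bdd_component_sq loc_bdd_cmult loc_bdd_component
          loc_bdd_const meanval_component_sq meanval_const meanval_cmult meanval_component)
  qed
  moreover have "meanval d x t (\<lambda>v. \<Sum>i<d. (v i - p i)\<^sup>2) = (\<Sum>i<d. meanval d x t (\<lambda>v. (v i - p i)\<^sup>2))"
    by (rule meanval_sum) (auto intro: loc_bdd_component_sq x)
  ultimately show ?thesis
    by (simp add: edist_sq sum.distrib)
qed

text \<open>A negative infimum of \<open>\<psi> - h\<close> would be attained in \<open>U\<close>,
  by lower semicontinuity and the boundary condition. At such a point \<open>\<psi>\<close> lies
  above a translate of \<open>h\<close> touching it, so the mean of \<open>h\<close> cannot exceed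
  its value there. Strictness of \<open>sub\<close> makes this single point a contradiction, without
  propagating the minimum through a component.\<close>

lemma min_principle_strict:
  assumes U: "openin (etop d) U" "U \<subseteq> ecball d p r" and \<psi>: "classical_superharmonic d U \<psi>"
    and h: "continuous_map (etop d) euclideanreal h"
    and sub: "\<And>x t. x \<in> Rd d \<Longrightarrow> 0 < t \<Longrightarrow> h x < meanval d x t h"
    and bdry: "\<And>z. z \<in> etop d frontier_of U \<Longrightarrow> ereal (h z) \<le> Liminf (atin_within (etop d) z U) \<psi>"
    and x1: "x1 \<in> U"
  shows "ereal (h x1) \<le> \<psi> x1"
proof (rule ccontr)
  assume neg: "\<not> ereal (h x1) \<le> \<psi> x1"
  have UR: "U \<subseteq> Rd d" using openin_subset[OF U(1)] by simp
  define F where "F x = \<psi> x - ereal (h x)" for x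
  define m where "m = (INF x\<in>U. F x)"
  have "F x1 < 0" using neg unfolding F_def by (cases "\<psi> x1") auto
  then have m0: "m < 0" using x1 unfolding m_def by (meson INF_lower le_less_trans)
  \<comment> \<open>Continuity of \<open>h\<close> turns a local lower bound \<open>b\<close> of
    \<open>\<psi>\<close> into a local lower bound \<open>a\<close> of \<open>F\<close>, given the
    margin \<open>a + h z < b\<close>.\<close>
  have nbhd: "\<exists>W. openin (etop d) W \<and> z \<in> W \<and> (\<forall>x\<in>W \<inter> U. ereal a \<le> F x)"
    if "openin (etop d) W0" "z \<in> W0" "\<forall>x\<in>W0 \<inter> U. ereal b < \<psi> x" "a + h z < b" for W0 z a b
  proof (intro exI conjI ballI)
    let ?W = "W0 \<inter> {x \<in> topspace (etop d). h x \<in> {..<b - a}}"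
    show "openin (etop d) ?W"
      using that(1) by (intro openin_Int openin_continuous_map_preimage[OF h]) auto
    show "z \<in> ?W" using that openin_subset[OF that(1)] by auto
    fix x assume "x \<in> ?W \<inter> U"
    then show "ereal a \<le> F x" using bspec[OF that(3), of x] unfolding F_def by (cases "\<psi> x") auto
  qed
  have "\<exists>x\<in>U. F x = m"
  proof (rule ccontr)
    assume "\<not> (\<exists>x\<in>U. F x = m)"
    then have gt: "m < F x" if "x \<in> U" for x
      using that INF_lower[of x U F] unfolding m_def by (metis order_le_less)
    \<comment> \<open>If the infimum were not attained, finitely many of these sets would cover the
      closure of \<open>U\<close>, and the smallest of their bounds would be a lower bound of
      \<open>F\<close> exceeding \<open>m\<close>.\<close>
    define \<C> where "\<C> = {W. openin (etop d) W \<and> (\<exists>a>m. \<forall>x\<in>W \<inter> U. a \<le> F x)}"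
    have comp: "compactin (etop d) (etop d closure_of U)"
      by (rule closed_compactin[OF compactin_ecball[of d p r]])
        (use U(2) in \<open>auto intro: closure_of_minimal[THEN subsetD]\<close>)
    have cover: "etop d closure_of U \<subseteq> \<Union>\<C>"
    proof
      fix z assume z: "z \<in> etop d closure_of U"
      have "\<exists>W0 a b. openin (etop d) W0 \<and> z \<in> W0 \<and> (\<forall>x\<in>W0 \<inter> U. ereal b < \<psi> x) \<and> a + h z < b \<and> m < ereal a"
      proof (cases "z \<in> U")
        case True
        obtain a where a: "m < ereal a" "ereal a < F z" using ereal_dense2[OF gt[OF True]] by blast
        have "ereal (a + h z) < \<psi> z" using a(2) unfolding F_def by (cases "\<psi> z") auto
        then obtain b where b: "ereal (a + h z) < ereal b" "ereal b < \<psi> z" using ereal_dense2 by blast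
        have "openin (etop d) {x \<in> U. ereal b < \<psi> x}"
          using \<psi> unfolding classical_superharmonic_def by blast
        then show ?thesis using a b True
          by (intro exI[of _ "{x \<in> U. ereal b < \<psi> x}"] exI[of _ a] exI[of _ b]) auto
      next
        case False
        then have fr: "z \<in> etop d frontier_of U"
          using z U by (simp add: frontier_of_def interior_of_openin)
        \<comment> \<open>Here \<open>m < 0\<close> enters: near the frontier \<open>F\<close> is
          bounded below by any chosen negative \<open>a\<close>, in particular by one above
          \<open>m\<close>.\<close>
        obtain a where a: "m < ereal a" "ereal a < 0" using ereal_dense2[OF m0] by blast
        obtain b where b: "a + h z < b" "b < h z" using dense[of "a + h z" "h z"] a by auto
        have "ereal b < Liminf (atin_within (etop d) z U) \<psi>"
          using less_le_trans[OF _ bdry[OF fr]] b by simp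
        then have "\<forall>\<^sub>F x in atin_within (etop d) z U. ereal b < \<psi> x" by (rule less_LiminfD)
        then obtain W0 where "openin (etop d) W0" "z \<in> W0" "\<forall>x\<in>W0. x \<in> U \<and> x \<noteq> z \<longrightarrow> ereal b < \<psi> x"
          using frontier_in_Rd[OF fr] by (auto simp: eventually_atin_within)
        then have "\<forall>x\<in>W0 \<inter> U. ereal b < \<psi> x" using False by blast
        with \<open>openin (etop d) W0\<close> \<open>z \<in> W0\<close> a(1) b(1) show ?thesis by blast
      qed
      then obtain W0 a b where W0: "openin (etop d) W0" "z \<in> W0" "\<forall>x\<in>W0 \<inter> U. ereal b < \<psi> x"
        "a + h z < b" and a: "m < ereal a" by blast
      obtain W where W: "openin (etop d) W" "z \<in> W" "\<forall>x\<in>W \<inter> U. ereal a \<le> F x"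
        using nbhd[OF W0] by blast
      then have "W \<in> \<C>" using a unfolding \<C>_def by blast
      then show "z \<in> \<Union>\<C>" using W(2) by blast
    qed
    obtain \<F> where \<F>: "finite \<F>" "\<F> \<subseteq> \<C>" "etop d closure_of U \<subseteq> \<Union>\<F>"
      using compactinD[OF comp, of \<C>] cover unfolding \<C>_def by auto
    then have "\<forall>W\<in>\<F>. \<exists>a>m. \<forall>x\<in>W \<inter> U. a \<le> F x" unfolding \<C>_def by blast
    then obtain a where a: "\<And>W. W \<in> \<F> \<Longrightarrow> m < a W" "\<And>W x. W \<in> \<F> \<Longrightarrow> x \<in> W \<inter> U \<Longrightarrow> a W \<le> F x" by metis
    have UF: "U \<subseteq> \<Union>\<F>" using \<F>(3) closure_of_subset[of U "etop d"] UR by auto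
    have ne: "\<F> \<noteq> {}" using UF x1 by auto
    have "Min (a ` \<F>) \<le> F x" if x: "x \<in> U" for x
    proof -
      obtain W where W: "W \<in> \<F>" "x \<in> W" using UF x by blast
      have "Min (a ` \<F>) \<le> a W" using W \<F>(1) by simp
      then show ?thesis using a(2)[of W x] W x by (meson IntI order_trans)
    qed
    then have "Min (a ` \<F>) \<le> m" unfolding m_def by (intro INF_greatest)
    moreover have "m < Min (a ` \<F>)" using a(1) \<F>(1) ne by simp
    ultimately show False by simp
  qed
  then obtain x where x: "x \<in> U" "F x = m" by blast
  \<comment> \<open>The value is finite: minus infinity is excluded by superharmonicity, plus
    infinity by \<open>m < 0\<close>.\<close>
  obtain c where c: "\<psi> x = ereal c"
    using x m0 \<psi> unfolding classical_superharmonic_def F_def by (cases "\<psi> x") auto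
  have le: "ereal (h y + (c - h x)) \<le> \<psi> y" if "y \<in> U" for y
  proof -
    have "m \<le> F y" using INF_lower[OF that] unfolding m_def .
    then show ?thesis using x(2) c unfolding F_def by (cases "\<psi> y") auto
  qed
  obtain t where t: "t > 0" "ecball d x t \<subseteq> U"
    using U x(1) unfolding Rd.openin_mtopology_mcball by blast
  have xR: "x \<in> Rd d" using x UR by blast
  have lb: "loc_bdd d (\<lambda>v. h v + (c - h x))" by (intro loc_bdd_add loc_bdd_continuous h loc_bdd_const)
  have "ereal (meanval d x t (\<lambda>v. h v + (c - h x))) \<le> ball_mean d x t \<psi>"
    using le t by (intro ball_mean_ge_meanval lb xR) auto
  also have "\<dots> \<le> \<psi> x" using \<psi> x t unfolding classical_superharmonic_def by blast
  finally have "meanval d x t h + (c - h x) \<le> c"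
    using meanval_add[OF loc_bdd_continuous[OF h] loc_bdd_const xR, of t "c - h x"] meanval_const[OF t(1) xR] c by simp
  then show False using sub[OF xR t(1)] by linarith
qed

text \<open>Adding \<open>e * ((edist d x p)\<^sup>2 - r\<^sup>2)\<close> makes the submean
  inequality strict and only lowers \<open>h\<close> on the closed ball, where the frontier of
  \<open>U\<close> lies. Then \<open>e\<close> tends to 0.\<close>

lemma min_principle:
  assumes d: "0 < d" and U: "openin (etop d) U" "U \<subseteq> ecball d p r" and \<psi>: "classical_superharmonic d U \<psi>"
    and h: "continuous_map (etop d) euclideanreal h"
    and sub: "\<And>x t. x \<in> Rd d \<Longrightarrow> 0 < t \<Longrightarrow> h x \<le> meanval d x t h"
    and bdry: "\<And>z. z \<in> etop d frontier_of U \<Longrightarrow> ereal (h z) \<le> Liminf (atin_within (etop d) z U) \<psi>"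
    and x1: "x1 \<in> U"
  shows "ereal (h x1) \<le> \<psi> x1"
proof -
  have *: "ereal (h x1 + e * ((edist d x1 p)\<^sup>2 - r\<^sup>2)) \<le> \<psi> x1" if e: "e > 0" for e
  proof (rule min_principle_strict[OF U \<psi> _ _ _ x1, where h = "\<lambda>x. h x + e * ((edist d x p)\<^sup>2 - r\<^sup>2)"])
    have sq: "continuous_map (etop d) euclideanreal (\<lambda>x. (edist d x p)\<^sup>2)"
      by (intro continuous_map_real_pow continuous_map_edist)
    have q: "continuous_map (etop d) euclideanreal (\<lambda>x. e * ((edist d x p)\<^sup>2 - r\<^sup>2))"
      by (intro continuous_map_real_mult continuous_map_diff sq) auto
    then show "continuous_map (etop d) euclideanreal (\<lambda>x. h x + e * ((edist d x p)\<^sup>2 - r\<^sup>2))"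
      by (intro continuous_map_add h)
    show "h x + e * ((edist d x p)\<^sup>2 - r\<^sup>2) < meanval d x t (\<lambda>x. h x + e * ((edist d x p)\<^sup>2 - r\<^sup>2))"
      if x: "x \<in> Rd d" and t: "0 < t" for x t
    proof -
      have "meanval d x t (\<lambda>x. h x + e * ((edist d x p)\<^sup>2 - r\<^sup>2))
          = meanval d x t h + e * ((edist d x p)\<^sup>2 + real d * moment d t - r\<^sup>2)"
        by (simp add: meanval_add[OF loc_bdd_continuous[OF h] loc_bdd_continuous[OF q] x] meanval_cmult
            meanval_diff[OF loc_bdd_continuous[OF sq] loc_bdd_const x] meanval_const[OF t x] meanval_edist_sq[OF x t])
      moreover have "0 < e * (real d * moment d t)" using e d moment_pos[OF d t] by simp
      ultimately show ?thesis using sub[OF x t] by (simp add: algebra_simps)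
    qed
    fix z assume z: "z \<in> etop d frontier_of U"
    have "z \<in> etop d closure_of U" using z by (simp add: frontier_of_def)
    then have "z \<in> ecball d p r" using U(2) closure_of_minimal Rd.closedin_mcball by blast
    then have "(edist d z p)\<^sup>2 \<le> r\<^sup>2" by (intro power_mono) (auto simp: edist_commute)
    then have "e * ((edist d z p)\<^sup>2 - r\<^sup>2) \<le> 0" using e by (simp add: mult_nonneg_nonpos)
    then show "ereal (h z + e * ((edist d z p)\<^sup>2 - r\<^sup>2)) \<le> Liminf (atin_within (etop d) z U) \<psi>"
      by (intro order_trans[OF _ bdry[OF z]]) simp
  qed
  show ?thesis
  proof (cases "\<psi> x1")
    case (real b)
    let ?c = "r\<^sup>2 - (edist d x1 p)\<^sup>2"
    have "x1 \<in> ecball d p r" using U(2) x1 by blast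
    then have c: "0 \<le> ?c" by (simp add: power_mono edist_commute)
    have "h x1 \<le> b + e" if e: "e > 0" for e
    proof -
      have "h x1 + e / (?c + 1) * ((edist d x1 p)\<^sup>2 - r\<^sup>2) \<le> b"
        using *[of "e / (?c + 1)"] real e c by simp
      moreover have "e / (?c + 1) * ?c \<le> e"
        using e c by (simp add: divide_le_eq mult_left_mono)
      moreover have "e / (?c + 1) * ((edist d x1 p)\<^sup>2 - r\<^sup>2) = - (e / (?c + 1) * ?c)"
        by (simp only: minus_diff_eq mult_minus_right[symmetric])
      ultimately show ?thesis by linarith
    qed
    then have "h x1 \<le> b" by (rule field_le_epsilon)
    then show ?thesis using real by simp
  qed (use *[of 1] in auto)
qed

section \<open>Minorants of the upper class\<close>

context
  fixes d :: nat and \<Omega> :: "(nat \<Rightarrow> real) set" and p :: "nat \<Rightarrow> real" and r :: real and \<psi>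
  assumes d: "0 < d" and \<Omega>: "openin (etop d) \<Omega>"
    and \<psi>: "\<psi> \<in> upper_class d (\<Omega> \<inter> eball d p r) (\<Omega> \<inter> etop d frontier_of (eball d p r))"
begin

text \<open>A frontier point of the intersection lies either in \<open>\<Omega>\<close>, hence on
  the sphere with boundary value 1, or on the frontier of \<open>\<Omega>\<close> with boundary
  value 0. The hypotheses \<open>le1\<close> and \<open>le0\<close> match these two cases.\<close>

lemma upper_class_ge:
  assumes h: "continuous_map (etop d) euclideanreal h"
    and sub: "\<And>x t. x \<in> Rd d \<Longrightarrow> 0 < t \<Longrightarrow> h x \<le> meanval d x t h"
    and le1: "\<And>x. x \<in> ecball d p r \<Longrightarrow> h x \<le> 1"
    and le0: "\<And>x. x \<in> ecball d p r \<Longrightarrow> x \<in> etop d frontier_of \<Omega> \<Longrightarrow> h x \<le> 0"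
    and y: "y \<in> \<Omega> \<inter> eball d p r"
  shows "ereal (h y) \<le> \<psi> y"
proof (rule min_principle[OF d _ _ _ h sub _ y])
  let ?U = "\<Omega> \<inter> eball d p r"
  show U: "openin (etop d) ?U" using \<Omega> by blast
  show "?U \<subseteq> ecball d p r" by auto
  show "classical_superharmonic d ?U \<psi>" using \<psi> by (simp add: upper_class_def)
  fix z assume z: "z \<in> etop d frontier_of ?U"
  then have zc: "z \<in> etop d closure_of ?U" and zn: "z \<notin> ?U"
    using U by (auto simp: frontier_of_def interior_of_openin)
  have zb: "z \<in> ecball d p r"
  proof -
    have "?U \<subseteq> ecball d p r" by auto
    then show ?thesis using zc closure_of_minimal[of ?U "ecball d p r" "etop d"] by blast
  qed
  have "ereal (h z) \<le> indicator (\<Omega> \<inter> etop d frontier_of (eball d p r)) z"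
  proof (cases "z \<in> \<Omega>")
    case True
    have "z \<in> etop d closure_of (eball d p r)" using zc closure_of_mono[of ?U "eball d p r"] by blast
    moreover have "z \<notin> eball d p r" using zn True by blast
    ultimately have "z \<in> etop d frontier_of (eball d p r)"
      by (simp add: frontier_of_def interior_of_openin[OF Rd.openin_mball] del: Rd.in_mball)
    then show ?thesis using True le1[OF zb] by simp
  next
    case False
    have "z \<in> etop d closure_of \<Omega>" using zc closure_of_mono[of ?U \<Omega>] by blast
    then have "z \<in> etop d frontier_of \<Omega>" using False \<Omega> by (simp add: frontier_of_def interior_of_openin)
    then show ?thesis using le0[OF zb] False by simp
  qed
  also have "\<dots> \<le> Liminf (atin_within (etop d) z ?U) \<psi>" using \<psi> z by (simp add: upper_class_def)
  finally show "ereal (h z) \<le> Liminf (atin_within (etop d) z ?U) \<psi>" .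
qed

lemma upper_class_nonneg:
  assumes "y \<in> \<Omega> \<inter> eball d p r" shows "0 \<le> \<psi> y"
  using upper_class_ge[of "\<lambda>_. 0" y] assms by (simp add: meanval_def zero_ereal_def)

text \<open>An affine function equal to \<open>1\<close> at the point of the sphere nearest to \<open>y\<close> and decreasing
  inwards is at most \<open>0\<close> on the part of the ball at distance at least half of the distance from
  \<open>y\<close> to the boundary, thanks to the curvature of the sphere.\<close>

lemma upper_class_near_sphere:
  assumes y: "y \<in> \<Omega> \<inter> eball d p r" and p: "p \<in> etop d frontier_of \<Omega>"
    and near: "16 * r * (r - edist d y p) \<le> (bdist d \<Omega> y)\<^sup>2"
  shows "ereal (1 / 2) \<le> \<psi> y"
proof -
  let ?\<rho> = "bdist d \<Omega> y"
  have \<rho>: "0 < ?\<rho>" using bdist_pos[OF \<Omega>, of y] p y by blast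
  define D where "D = edist d y p"
  have D\<rho>: "?\<rho> \<le> D" unfolding D_def by (rule bdist_le[OF p])
  have D: "0 < D" "D < r" using \<rho> D\<rho> y by (auto simp: D_def edist_commute)
  \<comment> \<open>The slope balances two demands: \<open>l \<le> 0\<close> as soon as
    \<open>r - S x / D\<close> is at least \<rho>^2 / (8 r), and \<open>l y \<ge> 1 / 2\<close>
    because \<open>near\<close> makes \<open>r - D\<close> at most half of that.
    \<open>S x / D\<close> is the coordinate of \<open>x\<close> along the direction from
    \<open>p\<close> to \<open>y\<close>.\<close>
  define A where "A = 8 * r / ?\<rho>\<^sup>2"
  have A: "0 < A" using \<rho> D by (simp add: A_def)
  define S where "S x = (\<Sum>i<d. (y i - p i) * (x i - p i))" for x :: "nat \<Rightarrow> real"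
  define l where "l x = 1 - A * (r - S x / D)" for x
  have Sc: "continuous_map (etop d) euclideanreal S"
    unfolding S_def
    by (intro continuous_map_sum continuous_map_real_mult continuous_map_diff) (auto intro: continuous_map_component)
  have lc: "continuous_map (etop d) euclideanreal l"
  proof -
    have "continuous_map (etop d) euclideanreal (\<lambda>x. 1 - A * (r - S x * (1 / D)))"
      by (intro continuous_map_real_mult continuous_map_diff Sc) auto
    then show ?thesis by (simp add: l_def[abs_def])
  qed
  have Sm: "meanval d x t S = S x" if x: "x \<in> Rd d" and t: "0 < t" for x t
  proof -
    have "meanval d x t S = (\<Sum>i<d. meanval d x t (\<lambda>v. (y i - p i) * (v i - p i)))"
      unfolding S_def by (intro meanval_sum loc_bdd_cmult loc_bdd_diff loc_bdd_const loc_bdd_component x) auto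
    also have "\<dots> = (\<Sum>i<d. (y i - p i) * (x i - p i))"
      by (intro sum.cong refl)
        (simp add: meanval_cmult meanval_diff loc_bdd_component loc_bdd_const meanval_component meanval_const x t)
    finally show ?thesis by (simp add: S_def)
  qed
  have lm: "meanval d x t l = l x" if x: "x \<in> Rd d" and t: "0 < t" for x t
  proof -
    have l: "l = (\<lambda>v. (1 - A * r) + A / D * S v)" by (auto simp: l_def fun_eq_iff algebra_simps)
    show ?thesis unfolding l
      by (subst meanval_add[OF loc_bdd_const loc_bdd_cmult[OF loc_bdd_continuous[OF Sc]] x])
        (simp only: meanval_cmult meanval_const[OF t x] Sm[OF x t])
  qed
  have hc: "continuous_map (etop d) euclideanreal (\<lambda>x. max 0 (l x))"
    by (intro continuous_map_real_max lc) auto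
  have S_le: "S x \<le> D * edist d x p" for x
  proof -
    have "S x \<le> (\<Sum>i<d. \<bar>y i - p i\<bar> * \<bar>x i - p i\<bar>)"
      unfolding S_def by (intro sum_mono) (simp flip: abs_mult)
    also have "\<dots> \<le> D * edist d x p" unfolding D_def edist_def by (rule L2_set_mult_ineq)
    finally show ?thesis .
  qed
  have "ereal (max 0 (l y)) \<le> \<psi> y"
  proof (rule upper_class_ge[OF hc _ _ _ y])
    show "max 0 (l x) \<le> meanval d x t (\<lambda>x. max 0 (l x))" if x: "x \<in> Rd d" and t: "0 < t" for x t
    proof -
      have "meanval d x t (\<lambda>_. 0) \<le> meanval d x t (\<lambda>x. max 0 (l x))"
        by (intro meanval_mono loc_bdd_const loc_bdd_continuous hc x t) auto
      moreover have "meanval d x t l \<le> meanval d x t (\<lambda>x. max 0 (l x))"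
        by (intro meanval_mono loc_bdd_continuous lc hc x t) auto
      ultimately show ?thesis by (simp add: lm meanval_const x t)
    qed
    show "max 0 (l x) \<le> 1" if x: "x \<in> ecball d p r" for x
    proof -
      have "D * edist d x p \<le> D * r" using x D by (intro mult_left_mono) (auto simp: edist_commute)
      with S_le[of x] have "S x \<le> D * r" by (rule order_trans)
      then have "S x / D \<le> r" using D by (simp add: divide_le_eq mult.commute)
      then show ?thesis using A by (simp add: l_def)
    qed
    show "max 0 (l z) \<le> 0" if z: "z \<in> ecball d p r" "z \<in> etop d frontier_of \<Omega>" for z
    proof -
      \<comment> \<open>The radial projection of \<open>y\<close> onto the sphere, where
        \<open>l\<close> equals 1.\<close>
      define q where "q i = p i + r / D * (y i - p i)" for i
      have "(edist d y q)\<^sup>2 = (1 - r / D)\<^sup>2 * (edist d y p)\<^sup>2"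
        unfolding edist_sq q_def sum_distrib_left
      proof (intro sum.cong refl)
        fix i
        have "y i - (p i + r / D * (y i - p i)) = (1 - r / D) * (y i - p i)" by (simp add: algebra_simps)
        then show "(y i - (p i + r / D * (y i - p i)))\<^sup>2 = (1 - r / D)\<^sup>2 * (y i - p i)\<^sup>2"
          by (simp add: power_mult_distrib)
      qed
      also have "\<dots> = (1 - r / D)\<^sup>2 * D\<^sup>2" by (simp add: D_def)
      also have "\<dots> = (r - D)\<^sup>2" using D by (simp add: power_mult_distrib[symmetric] algebra_simps power2_commute)
      finally have yq: "edist d y q = r - D" using D by (simp add: power2_eq_iff_nonneg)
      \<comment> \<open>Since \<open>?\<rho> \<le> D < r\<close>, the hypothesis \<open>near\<close>
        puts \<open>q\<close> within \<rho> / 16 of \<open>y\<close>, so a boundary point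
        \<open>z\<close> stays at distance at least \<rho> / 2 from \<open>q\<close>.\<close>
      have rD: "r - D \<le> ?\<rho> / 16"
      proof -
        have "16 * ?\<rho> * (r - D) \<le> 16 * r * (r - D)" using D D\<rho> by (intro mult_right_mono) auto
        also have "\<dots> \<le> ?\<rho> * ?\<rho>" using near by (simp add: D_def power2_eq_square)
        finally have "?\<rho> * (16 * (r - D)) \<le> ?\<rho> * ?\<rho>" by (simp only: mult_ac)
        then show ?thesis using \<rho> by simp
      qed
      have "?\<rho> / 2 \<le> edist d z q"
        using bdist_le[OF z(2), of y] edist_triangle[of d y z q] yq rD \<rho> by (simp add: edist_commute)
      then have "(?\<rho> / 2)\<^sup>2 \<le> (edist d z q)\<^sup>2" using \<rho> by (intro power_mono) auto
      also have "(edist d z q)\<^sup>2 = (edist d z p)\<^sup>2 - 2 * (r / D) * S z + (r / D)\<^sup>2 * (edist d y p)\<^sup>2"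
        unfolding edist_sq S_def q_def sum_distrib_left sum_subtractf[symmetric] sum.distrib[symmetric]
        by (intro sum.cong refl) (simp add: power2_eq_square algebra_simps)
      also have "\<dots> = (edist d z p)\<^sup>2 - 2 * r * (S z / D) + r\<^sup>2"
        using D by (simp add: D_def[symmetric] power_divide)
      \<comment> \<open>The curvature estimate: \<open>q\<close> has distance \<open>r\<close> from
        \<open>p\<close> and \<open>z\<close> at most \<open>r\<close>, so the squared distance of
        \<open>z\<close> and \<open>q\<close> is bounded by the depth of \<open>z\<close> below the
        tangent plane at \<open>q\<close>.\<close>
      also have "\<dots> \<le> 2 * r * (r - S z / D)"
      proof -
        have "(edist d z p)\<^sup>2 \<le> r\<^sup>2" using z(1) by (intro power_mono) (auto simp: edist_commute)
        then show ?thesis by (simp add: power2_eq_square algebra_simps)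
      qed
      finally have "?\<rho>\<^sup>2 \<le> 8 * r * (r - S z / D)" by (simp add: power_divide)
      then have "1 \<le> A * (r - S z / D)" using \<rho> by (simp add: A_def le_divide_eq)
      then show ?thesis by (simp add: l_def)
    qed
  qed
  moreover have "1 / 2 \<le> l y"
  proof -
    have "S y = D\<^sup>2" unfolding S_def D_def edist_sq by (simp add: power2_eq_square)
    then have "S y / D = D" using D by (simp add: power2_eq_square)
    then have "A * (r - S y / D) \<le> 1 / 2"
      using near \<rho> by (simp add: A_def D_def[symmetric] divide_le_eq)
    then show ?thesis by (simp add: l_def)
  qed
  ultimately show ?thesis by (metis ereal_less_eq(3) max.coboundedI2 order_trans)
qed

end

section \<open>The infimum of the scaled majorants\<close>

text \<open>\<open>\<theta>\<close> and \<open>\<epsilon>\<close> are parameters because they are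
  chosen before the dimension and the domain and enter the final constant.\<close>

locale lhmd_domain =
  fixes d :: nat and \<Omega> :: "(nat \<Rightarrow> real) set" and \<alpha> \<beta> M \<theta> \<epsilon> :: real
  assumes d: "2 \<le> d" and \<Omega>: "openin (etop d) \<Omega>" "\<Omega> \<noteq> {}" "\<Omega> \<subset> Rd d"
    and lhmd: "LHMD d \<Omega> \<alpha> M"
    and const: "0 < \<alpha>" "0 < M" "0 < \<beta>" "\<beta> < \<alpha>"
    and \<theta>: "0 < \<theta>" "\<theta> < 1" "M * \<theta> powr (\<alpha> - \<beta>) \<le> 1 / 4"
    and \<epsilon>_def: "\<epsilon> = \<theta> powr \<beta> / 8"
begin

abbreviation "\<rho> \<equiv> bdist d \<Omega>"
abbreviation "bd \<equiv> etop d frontier_of \<Omega>"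
abbreviation "upper p r \<equiv> upper_class d (\<Omega> \<inter> eball d p r) (\<Omega> \<inter> etop d frontier_of (eball d p r))"

section \<open>The candidates and two-sided bounds for their infimum\<close>

lemma \<epsilon>_pos: "0 < \<epsilon>" using \<theta> by (simp add: \<epsilon>_def)

lemma in_Rd: "y \<in> \<Omega> \<Longrightarrow> y \<in> Rd d" using \<Omega> by auto

lemma bd_nonempty: "bd \<noteq> {}" using frontier_nonempty \<Omega> by blast

lemma \<rho>_pos: "y \<in> \<Omega> \<Longrightarrow> 0 < \<rho> y" using bdist_pos \<Omega> bd_nonempty by blast

text \<open>Real upper bounds \<open>b\<close> of \<open>\<psi> y\<close> replace \<open>\<psi> y\<close> itself, so that the infimum is taken in the reals.\<close>

definition cand :: "(nat \<Rightarrow> real) \<Rightarrow> real set" where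
  "cand y = {r powr \<beta> * (b + \<epsilon>) | p r b.
     p \<in> bd \<and> edist d y p < r \<and> (\<exists>\<psi>\<in>upper p r. \<psi> y \<le> ereal b)}"

lemma candI:
  "p \<in> bd \<Longrightarrow> edist d y p < r \<Longrightarrow> \<psi> \<in> upper p r \<Longrightarrow> \<psi> y \<le> ereal b \<Longrightarrow> r powr \<beta> * (b + \<epsilon>) \<in> cand y"
  unfolding cand_def by blast

text \<open>The decay property bounds an infimum over the upper class, so a strict inequality is
  required to obtain a member. Where this is applied, an extra \<open>\<epsilon>\<close> supplies
  the strictness.\<close>

lemma upper_exists:
  assumes "y \<in> \<Omega>" "p \<in> bd" "edist d y p < r" "M * (edist d y p / r) powr \<alpha> < b"
  obtains \<psi> where "\<psi> \<in> upper p r" "\<psi> y \<le> ereal b"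
proof -
  have r: "0 < r" using assms(3) by (metis Rd.nonneg order_le_less_trans)
  have "y \<in> \<Omega> \<inter> eball d p r"
    using assms in_Rd frontier_in_Rd by (auto simp: edist_commute)
  then have "local_harmonic_measure d \<Omega> y p r \<le> ereal (M * (edist d y p / r) powr \<alpha>)"
    using lhmd assms(2) r unfolding LHMD_def by blast
  also have "\<dots> < ereal b" using assms(4) by simp
  finally have "(INF \<psi>\<in>upper p r. \<psi> y) < ereal b"
    by (simp add: local_harmonic_measure_def harmonic_measure_def)
  then obtain \<psi> where "\<psi> \<in> upper p r" "\<psi> y < ereal b" by (auto simp: INF_less_iff)
  then show thesis using that by auto
qed

lemma upper_nonneg:
  assumes "y \<in> \<Omega>" "p \<in> bd" "edist d y p < r" "\<psi> \<in> upper p r"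
  shows "0 \<le> \<psi> y"
  by (rule upper_class_nonneg[OF _ \<Omega>(1) assms(4)])
    (use d assms in_Rd frontier_in_Rd in \<open>auto simp: edist_commute\<close>)

text \<open>Here the summand \<open>\<epsilon>\<close> does its work: \<open>b\<close> may be 0, but
  \<open>r\<close> exceeds \<open>\<rho> y\<close> because \<open>p\<close> is a boundary
  point.\<close>

lemma cand_ge:
  assumes y: "y \<in> \<Omega>" and s: "s \<in> cand y"
  shows "\<epsilon> * \<rho> y powr \<beta> \<le> s"
proof -
  obtain p r b \<psi> where s: "s = r powr \<beta> * (b + \<epsilon>)" and p: "p \<in> bd" and r: "edist d y p < r"
    and \<psi>: "\<psi> \<in> upper p r" "\<psi> y \<le> ereal b" using s unfolding cand_def by blast
  have b: "0 \<le> b" using order_trans[OF upper_nonneg[OF y p r \<psi>(1)] \<psi>(2)] by simp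
  have "\<rho> y < r" using bdist_le[OF p, of y] r by simp
  then have "\<rho> y powr \<beta> \<le> r powr \<beta>" using \<rho>_pos[OF y] const by (intro powr_mono2) auto
  then have "\<rho> y powr \<beta> * \<epsilon> \<le> r powr \<beta> * (b + \<epsilon>)" using b \<epsilon>_pos by (intro mult_mono) auto
  then show ?thesis by (simp add: s mult.commute)
qed

text \<open>A boundary point \<open>p\<close> closer than \<open>2 * \<rho> y\<close> serves as
  centre, with radius \<open>2 * \<rho> y\<close>. The quotient in the decay bound is then at most 1
  and the bound at most \<open>M\<close>.\<close>

lemma cand_upper_bound:
  assumes y: "y \<in> \<Omega>"
  shows "\<exists>s\<in>cand y. s \<le> 2 powr \<beta> * (M + 2 * \<epsilon>) * \<rho> y powr \<beta>"
proof -
  obtain p where p: "p \<in> bd" "edist d y p < 2 * \<rho> y"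
    using bdist_less_obtains[OF bd_nonempty, of y "2 * \<rho> y"] \<rho>_pos[OF y] by auto
  have "(edist d y p / (2 * \<rho> y)) powr \<alpha> \<le> 1 powr \<alpha>"
    using p \<rho>_pos[OF y] const by (intro powr_mono2) (auto simp: divide_le_eq)
  then have "M * (edist d y p / (2 * \<rho> y)) powr \<alpha> \<le> M * 1"
    using const by (intro mult_left_mono) auto
  then have "M * (edist d y p / (2 * \<rho> y)) powr \<alpha> < M + \<epsilon>" using \<epsilon>_pos by simp
  then obtain \<psi> where "\<psi> \<in> upper p (2 * \<rho> y)" "\<psi> y \<le> ereal (M + \<epsilon>)" by (rule upper_exists[OF y p])
  then have "(2 * \<rho> y) powr \<beta> * (M + \<epsilon> + \<epsilon>) \<in> cand y" by (rule candI[OF p])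
  moreover have "(2 * \<rho> y) powr \<beta> * (M + \<epsilon> + \<epsilon>) = 2 powr \<beta> * (M + 2 * \<epsilon>) * \<rho> y powr \<beta>"
    using \<rho>_pos[OF y] by (simp add: powr_mult)
  ultimately show ?thesis by auto
qed

definition cand_inf :: "(nat \<Rightarrow> real) \<Rightarrow> real" where
  "cand_inf y = Inf (cand y)"

lemma cand_inf_le: "y \<in> \<Omega> \<Longrightarrow> s \<in> cand y \<Longrightarrow> cand_inf y \<le> s"
  unfolding cand_inf_def using cand_ge by (intro cInf_lower bdd_belowI) auto

lemma cand_inf_greatest: "y \<in> \<Omega> \<Longrightarrow> (\<And>s. s \<in> cand y \<Longrightarrow> c \<le> s) \<Longrightarrow> c \<le> cand_inf y"
  unfolding cand_inf_def using cand_upper_bound by (intro cInf_greatest) auto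

lemma cand_inf_ge: "y \<in> \<Omega> \<Longrightarrow> \<epsilon> * \<rho> y powr \<beta> \<le> cand_inf y"
  using cand_inf_greatest cand_ge by blast

lemma cand_inf_upper_bound: "y \<in> \<Omega> \<Longrightarrow> cand_inf y \<le> 2 powr \<beta> * (M + 2 * \<epsilon>) * \<rho> y powr \<beta>"
  using cand_upper_bound cand_inf_le order_trans by meson

lemma cand_inf_nonneg: "y \<in> \<Omega> \<Longrightarrow> 0 \<le> cand_inf y"
  using cand_inf_ge \<epsilon>_pos by (meson mult_nonneg_nonneg order_trans powr_ge_zero less_imp_le)

section \<open>Lower semicontinuous regularization of the infimum\<close>

definition lower :: "(nat \<Rightarrow> real) \<Rightarrow> real set" where
  "lower y = {a. \<exists>\<delta>>0. \<forall>z\<in>\<Omega> \<inter> eball d y \<delta>. a \<le> cand_inf z}"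

definition reg :: "(nat \<Rightarrow> real) \<Rightarrow> real" where
  "reg y = (if y \<in> \<Omega> then Sup (lower y) else 0)"

lemma lower_le: "y \<in> \<Omega> \<Longrightarrow> a \<in> lower y \<Longrightarrow> a \<le> cand_inf y"
  unfolding lower_def using in_Rd by force

lemma reg_ge: "y \<in> \<Omega> \<Longrightarrow> a \<in> lower y \<Longrightarrow> a \<le> reg y"
  unfolding reg_def using lower_le by (auto intro!: cSup_upper bdd_aboveI[of _ "cand_inf y"])

lemma zero_in_lower: "0 \<in> lower y"
  unfolding lower_def using cand_inf_nonneg zero_less_one by blast

lemma reg_le: "y \<in> \<Omega> \<Longrightarrow> reg y \<le> cand_inf y"
  unfolding reg_def using lower_le zero_in_lower by (auto intro!: cSup_least)

lemma reg_nonneg: "0 \<le> reg y"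
  using reg_ge[OF _ zero_in_lower] by (cases "y \<in> \<Omega>") (auto simp: reg_def)

lemma reg_upper_bound: "y \<in> \<Omega> \<Longrightarrow> reg y \<le> 2 powr \<beta> * (M + 2 * \<epsilon>) * \<rho> y powr \<beta>"
  using reg_le cand_inf_upper_bound order_trans by blast

text \<open>On the ball of radius \<open>\<rho> y / 2\<close> the distance to the boundary is still
  at least \<open>\<rho> y / 2\<close>; this costs the factor \<open>2 powr \<beta>\<close>.\<close>

lemma reg_lower_bound:
  assumes y: "y \<in> \<Omega>"
  shows "\<epsilon> / 2 powr \<beta> * \<rho> y powr \<beta> \<le> reg y"
proof (rule reg_ge[OF y])
  have "\<epsilon> / 2 powr \<beta> * \<rho> y powr \<beta> \<le> cand_inf z" if z: "z \<in> \<Omega> \<inter> eball d y (\<rho> y / 2)" for z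
  proof -
    have "\<rho> y / 2 \<le> \<rho> z" using bdist_lipschitz[OF bd_nonempty, of y z] z by auto
    then have "(\<rho> y / 2) powr \<beta> \<le> \<rho> z powr \<beta>" using \<rho>_pos[OF y] const by (intro powr_mono2) auto
    then have "\<epsilon> * (\<rho> y / 2) powr \<beta> \<le> \<epsilon> * \<rho> z powr \<beta>" using \<epsilon>_pos by simp
    also have "\<dots> \<le> cand_inf z" using cand_inf_ge z by blast
    finally show ?thesis using \<rho>_pos[OF y] by (simp add: powr_divide)
  qed
  then show "\<epsilon> / 2 powr \<beta> * \<rho> y powr \<beta> \<in> lower y"
    unfolding lower_def using \<rho>_pos[OF y] half_gt_zero by blast
qed

lemma reg_lsc: "openin (etop d) {y \<in> \<Omega>. a < reg y}"
  unfolding Rd.openin_mtopology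
proof (intro conjI allI impI)
  show "{y \<in> \<Omega>. a < reg y} \<subseteq> Rd d" using \<Omega> by auto
  fix y assume "y \<in> {y \<in> \<Omega>. a < reg y}"
  then have y: "y \<in> \<Omega>" "a < reg y" by auto
  then obtain b where b: "b \<in> lower y" "a < b"
    using less_cSupD[of "lower y" a] zero_in_lower[of y] by (auto simp: reg_def)
  then obtain \<delta> where \<delta>: "\<delta> > 0" "\<And>z. z \<in> \<Omega> \<inter> eball d y \<delta> \<Longrightarrow> b \<le> cand_inf z"
    unfolding lower_def by blast
  obtain \<eta> where \<eta>: "\<eta> > 0" "eball d y \<eta> \<subseteq> \<Omega>"
    using \<Omega>(1) y unfolding Rd.openin_mtopology by blast
  have "a < reg z" if z: "z \<in> eball d y (min \<delta> \<eta>)" for z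
  proof -
    have zO: "z \<in> \<Omega>" using z \<eta>(2) by auto
    have "b \<le> cand_inf w" if w: "w \<in> \<Omega> \<inter> eball d z (\<delta> - edist d y z)" for w
      using w z edist_triangle[of d y w z] by (intro \<delta>(2)) auto
    moreover have "0 < \<delta> - edist d y z" using z by simp
    ultimately have "b \<in> lower z" unfolding lower_def by blast
    then show ?thesis using reg_ge[OF zO] b(2) by fastforce
  qed
  moreover have "eball d y (min \<delta> \<eta>) \<subseteq> \<Omega>" using \<eta>(2) by auto
  ultimately show "\<exists>r>0. eball d y r \<subseteq> {y \<in> \<Omega>. a < reg y}"
    using \<delta>(1) \<eta>(1) by (intro exI[of _ "min \<delta> \<eta>"]) auto
qed

text \<open>Supplies the sequence of centres along which \<open>cand_inf\<close> comes down to the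
  regularization.\<close>

lemma reg_approx:
  assumes y: "y \<in> \<Omega>" and "0 < \<eta>" "0 < \<delta>"
  shows "\<exists>z\<in>\<Omega> \<inter> eball d y \<delta>. cand_inf z < reg y + \<eta>"
proof (rule ccontr)
  assume "\<not> ?thesis"
  then have "reg y + \<eta> \<in> lower y" using assms(3) unfolding lower_def by (force simp: not_less)
  from reg_ge[OF y this] assms(2) show False by simp
qed

lemma loc_bdd_reg: "loc_bdd d reg"
  unfolding loc_bdd_def
proof (intro conjI ballI allI)
  show "reg \<in> borel_measurable (lebP d)"
    unfolding borel_measurable_iff_greater
  proof
    fix a
    show "{w \<in> space (lebP d). a < reg w} \<in> sets (lebP d)"
    proof (cases "0 \<le> a")
      case True
      then have "{w \<in> space (lebP d). a < reg w} = {y \<in> \<Omega>. a < reg y}"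
        using in_Rd by (auto simp: reg_def space_lebP)
      then show ?thesis using openin_sets_lebP[OF reg_lsc] by simp
    next
      case False
      then have "{w \<in> space (lebP d). a < reg w} = space (lebP d)"
        using reg_nonneg by (auto intro!: less_le_trans[OF _ reg_nonneg])
      then show ?thesis by simp
    qed
  qed
  fix x t
  obtain p where p: "p \<in> bd" using bd_nonempty by blast
  let ?C = "2 powr \<beta> * (M + 2 * \<epsilon>)"
  have "\<bar>reg v\<bar> \<le> ?C * (t + edist d x p) powr \<beta>" if v: "v \<in> ecball d x t" for v
  proof (cases "v \<in> \<Omega>")
    case True
    have "\<rho> v \<le> t + edist d x p"
      using bdist_le[OF p, of v] edist_triangle[of d v p x] v by (auto simp: edist_commute)
    then have "?C * \<rho> v powr \<beta> \<le> ?C * (t + edist d x p) powr \<beta>"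
      using \<rho>_pos[OF True] const \<epsilon>_pos by (intro mult_left_mono powr_mono2) auto
    then show ?thesis using reg_upper_bound[OF True] reg_nonneg[of v] by linarith
  qed (use const \<epsilon>_pos in \<open>simp add: reg_def\<close>)
  then show "\<exists>C. \<forall>v\<in>ecball d x t. \<bar>reg v\<bar> \<le> C" by blast
qed

section \<open>Mean-value inequalities and superharmonicity of the regularization\<close>

lemma meanval_reg_le_candidate:
  assumes y: "y \<in> \<Omega>" and p: "p \<in> bd" and t: "0 < t" "t < \<rho> y" "edist d y p + t < r"
    and \<psi>: "\<psi> \<in> upper p r" "\<psi> y \<le> ereal b"
  shows "meanval d y t reg \<le> r powr \<beta> * (b + \<epsilon>)"
proof -
  have r: "0 < r" using t(1,3) by (metis Rd.nonneg add_nonneg_pos less_trans)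
  then have R: "0 < r powr \<beta>" by simp
  have sub: "ecball d y t \<subseteq> \<Omega> \<inter> eball d p r"
  proof
    fix x assume x: "x \<in> ecball d y t"
    have "x \<in> \<Omega>" using x t by (intro mem_of_edist_less_bdist[OF y in_Rd[OF y]]) auto
    moreover have "edist d p x < r" using x t(3) edist_triangle[of d p x y] by (auto simp: edist_commute)
    ultimately show "x \<in> \<Omega> \<inter> eball d p r" using x frontier_in_Rd[OF p] by auto
  qed
  let ?f = "\<lambda>x. 1 / r powr \<beta> * reg x + (- \<epsilon>)"
  \<comment> \<open>The same \<open>\<psi>\<close> provides a candidate at every point of the ball
    where it is finite, so the rescaled regularization is a measurable minorant of it, and the
    super-mean-value property of \<open>\<psi>\<close> at \<open>y\<close> can be used.\<close>
  have le: "ereal (?f x) \<le> \<psi> x" if x: "x \<in> ecball d y t" for x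
  proof -
    have "x \<in> \<Omega> \<inter> eball d p r" using sub x by blast
    then have xU: "x \<in> \<Omega>" "edist d x p < r" by (auto simp: edist_commute)
    show ?thesis
    proof (cases "\<psi> x")
      case (real c)
      have "r powr \<beta> * (c + \<epsilon>) \<in> cand x" using real by (intro candI[OF p xU(2) \<psi>(1)]) simp
      then have "reg x \<le> r powr \<beta> * (c + \<epsilon>)"
        using reg_le[OF xU(1)] cand_inf_le[OF xU(1)] by (meson order_trans)
      then have "reg x / r powr \<beta> \<le> c + \<epsilon>" using R by (simp add: divide_le_eq mult.commute)
      then show ?thesis using real by simp
    qed (use upper_nonneg[OF xU(1) p xU(2) \<psi>(1)] in auto)
  qed
  have "ereal (meanval d y t ?f) \<le> ball_mean d y t \<psi>"
    by (intro ball_mean_ge_meanval le loc_bdd_add loc_bdd_cmult loc_bdd_reg loc_bdd_const in_Rd y t)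
  also have "\<dots> \<le> \<psi> y"
  proof -
    have "y \<in> ecball d y t" using in_Rd[OF y] t(1) by simp
    then have "y \<in> \<Omega> \<inter> eball d p r" using sub by blast
    moreover have "classical_superharmonic d (\<Omega> \<inter> eball d p r) \<psi>" using \<psi>(1) by (simp add: upper_class_def)
    ultimately show ?thesis using t(1) sub unfolding classical_superharmonic_def by blast
  qed
  also have "\<dots> \<le> ereal b" by (rule \<psi>(2))
  finally have "meanval d y t ?f \<le> b" by simp
  moreover have "meanval d y t ?f = meanval d y t reg / r powr \<beta> - \<epsilon>"
    by (subst meanval_add[OF loc_bdd_cmult[OF loc_bdd_reg] loc_bdd_const in_Rd[OF y]])
      (simp only: meanval_cmult meanval_const[OF t(1) in_Rd[OF y]], simp)
  ultimately have "meanval d y t reg / r powr \<beta> \<le> b + \<epsilon>" by linarith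
  then show ?thesis using R by (simp add: divide_le_eq mult.commute)
qed

lemma meanval_reg_le_radius:
  assumes y: "y \<in> \<Omega>" and p: "p \<in> bd" and t: "0 < t" "t < \<rho> y" "edist d y p + t < r"
    and b: "M * (edist d y p / r) powr \<alpha> < b"
  shows "meanval d y t reg \<le> r powr \<beta> * (b + \<epsilon>)"
proof -
  have "edist d y p < r" using t by simp
  then obtain \<psi> where "\<psi> \<in> upper p r" "\<psi> y \<le> ereal b" using upper_exists[OF y p _ b] by blast
  then show ?thesis by (rule meanval_reg_le_candidate[OF y p t])
qed

text \<open>The solution of \<open>\<epsilon> * (\<Lambda> * \<rho> y) powr \<beta> = (4 * \<rho> y)
  powr \<beta> * (M + 2 * \<epsilon>)\<close>: beyond radius \<open>\<Lambda> * \<rho> y\<close> a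
  candidate exceeds the bound obtained with radius \<open>4 * \<rho> y\<close>.\<close>

definition \<Lambda> :: real where "\<Lambda> = 4 * ((M + 2 * \<epsilon>) / \<epsilon>) powr (1 / \<beta>)"
text \<open>The first entry leaves room for the ball of radius t around \<open>y\<close> inside
  radius \<open>r / \<theta>\<close>. The second makes
  \<open>16 * r * (r - edist d y p) \<le> (\<rho> y)\<^sup>2\<close> when that ball reaches the
  sphere and \<open>r \<le> \<Lambda> * \<rho> y\<close>.\<close>

definition \<kappa> :: real where "\<kappa> = min ((1 - \<theta>) / 2) (1 / (16 * \<Lambda>))"

lemma \<Lambda>_pos: "0 < \<Lambda>"
  using \<epsilon>_pos const by (simp add: \<Lambda>_def add_pos_pos)

lemma \<kappa>_bounds: "0 < \<kappa>" "\<kappa> \<le> 1 / 2" "16 * \<Lambda> * \<kappa> \<le> 1" "\<kappa> \<le> (1 - \<theta>) / 2"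
proof -
  show "0 < \<kappa>" using \<theta> \<Lambda>_pos by (simp add: \<kappa>_def)
  show k: "\<kappa> \<le> (1 - \<theta>) / 2" unfolding \<kappa>_def by (rule min.cobounded1)
  then show "\<kappa> \<le> 1 / 2" using \<theta> by simp
  have "\<kappa> \<le> 1 / (16 * \<Lambda>)" by (simp add: \<kappa>_def)
  then show "16 * \<Lambda> * \<kappa> \<le> 1" using \<Lambda>_pos by (simp add: le_divide_eq mult.commute)
qed

text \<open>Every candidate at \<open>y\<close> has to dominate the mean. If the ball fits into its
  domain, it does so by itself. Otherwise there is a competitor whose domain contains the ball and
  whose bound at \<open>y\<close> is no larger.\<close>

lemma meanval_reg_le_cand_inf:
  assumes y: "y \<in> \<Omega>" and t: "0 < t" "t \<le> \<kappa> * \<rho> y"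
  shows "meanval d y t reg \<le> cand_inf y"
proof (rule cand_inf_greatest[OF y])
  fix s assume "s \<in> cand y"
  then obtain p r b \<psi> where s: "s = r powr \<beta> * (b + \<epsilon>)" and p: "p \<in> bd" and r: "edist d y p < r"
    and \<psi>: "\<psi> \<in> upper p r" "\<psi> y \<le> ereal b" unfolding cand_def by blast
  have \<rho>: "0 < \<rho> y" by (rule \<rho>_pos[OF y])
  have "\<kappa> * \<rho> y \<le> 1 / 2 * \<rho> y" using \<kappa>_bounds \<rho> by (intro mult_right_mono) auto
  then have t2: "t < \<rho> y" using t \<rho> by linarith
  have \<rho>r: "\<rho> y \<le> edist d y p" "\<rho> y < r" using bdist_le[OF p, of y] r by auto
  have r0: "0 < r" using \<rho>r \<rho> by simp
  have b0: "0 \<le> b" using order_trans[OF upper_nonneg[OF y p r \<psi>(1)] \<psi>(2)] by simp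
  consider "edist d y p + t < r" | "r \<le> edist d y p + t" "r \<le> \<Lambda> * \<rho> y" | "\<Lambda> * \<rho> y < r" by linarith
  then show "meanval d y t reg \<le> s"
  proof cases
    case 1
    then show ?thesis unfolding s by (rule meanval_reg_le_candidate[OF y p t(1) t2 _ \<psi>])
  next
    case 2
    \<comment> \<open>the candidate is close to its sphere; the ones with the same centre and radius \<open>r / \<theta>\<close> are smaller\<close>
    have "16 * r * (r - edist d y p) \<le> 16 * (\<Lambda> * \<rho> y) * (\<kappa> * \<rho> y)"
      using 2 r t r0 \<Lambda>_pos \<rho> by (intro mult_mono) auto
    also have "\<dots> = (16 * \<Lambda> * \<kappa>) * (\<rho> y)\<^sup>2" by (simp add: power2_eq_square)
    also have "\<dots> \<le> 1 * (\<rho> y)\<^sup>2" using \<kappa>_bounds by (intro mult_right_mono) auto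
    finally have near: "16 * r * (r - edist d y p) \<le> (\<rho> y)\<^sup>2" by simp
    have yU: "y \<in> \<Omega> \<inter> eball d p r" using y r in_Rd frontier_in_Rd[OF p] by (auto simp: edist_commute)
    have "ereal (1 / 2) \<le> ereal b"
      using order_trans[OF upper_class_near_sphere[OF _ \<Omega>(1) \<psi>(1) yU p near] \<psi>(2)] d by simp
    then have b: "1 / 2 \<le> b" by simp
    have "edist d y p / (r / \<theta>) < \<theta>" using r r0 \<theta> by (simp add: divide_less_eq mult.commute)
    then have "(edist d y p / (r / \<theta>)) powr \<alpha> \<le> \<theta> powr \<alpha>"
      using const \<theta> r0 by (intro powr_mono2) auto
    then have "M * (edist d y p / (r / \<theta>)) powr \<alpha> \<le> M * \<theta> powr \<alpha>" using const by simp
    then have bb: "M * (edist d y p / (r / \<theta>)) powr \<alpha> < M * \<theta> powr \<alpha> + \<epsilon>" using \<epsilon>_pos by simp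
    have "t \<le> (1 - \<theta>) / 2 * \<rho> y" using t \<kappa>_bounds \<rho> by (meson mult_right_mono order_trans less_imp_le)
    also have "\<dots> \<le> (1 - \<theta>) / 2 * r" using \<rho>r \<theta> by (intro mult_left_mono) auto
    also have "\<dots> = (1 - \<theta>) * r * (1 / 2)" by simp
    also have "\<dots> < (1 - \<theta>) * r * (1 / \<theta>)"
      using \<theta> r0 by (intro mult_strict_left_mono) (auto simp: less_divide_eq)
    also have "\<dots> = r / \<theta> - r" using \<theta> by (simp add: field_simps)
    finally have "edist d y p + t < r / \<theta>" using r by linarith
    then have "meanval d y t reg \<le> (r / \<theta>) powr \<beta> * (M * \<theta> powr \<alpha> + \<epsilon> + \<epsilon>)"
      by (rule meanval_reg_le_radius[OF y p t(1) t2 _ bb])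
    \<comment> \<open>\<open>\<epsilon> = \<theta> powr \<beta> / 8\<close> turns the two
      \<open>\<epsilon>\<close> into 1/4 after division by \<open>\<theta> powr \<beta>\<close>. By
      the choice of \<open>\<theta>\<close> the bracket is at most 1/2, hence at most
      \<open>b\<close>.\<close>
    also have "\<dots> = r powr \<beta> * (M * \<theta> powr (\<alpha> - \<beta>) + 1 / 4)"
      using \<theta> r0 by (simp add: powr_divide powr_diff \<epsilon>_def field_simps)
    also have "\<dots> \<le> r powr \<beta> * (b + \<epsilon>)" using \<theta>(3) b \<epsilon>_pos by (intro mult_left_mono) auto
    finally show ?thesis by (simp add: s)
  next
    case 3
    \<comment> \<open>Radius \<open>4 * \<rho> y\<close> suffices for the competitor: its centre is
      closer than \<open>2 * \<rho> y\<close> and \<open>t < \<rho> y\<close>.\<close>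
    obtain q where q: "q \<in> bd" "edist d y q < 2 * \<rho> y"
      using bdist_less_obtains[OF bd_nonempty, of y "2 * \<rho> y"] \<rho> by auto
    have "(edist d y q / (4 * \<rho> y)) powr \<alpha> \<le> 1 powr \<alpha>"
      using q \<rho> const by (intro powr_mono2) (auto simp: divide_le_eq)
    then have "M * (edist d y q / (4 * \<rho> y)) powr \<alpha> \<le> M * 1"
      using const by (intro mult_left_mono) auto
    then have bb: "M * (edist d y q / (4 * \<rho> y)) powr \<alpha> < M + \<epsilon>" using \<epsilon>_pos by simp
    have "edist d y q + t < 4 * \<rho> y" using q t2 \<rho> by simp
    then have "meanval d y t reg \<le> (4 * \<rho> y) powr \<beta> * (M + \<epsilon> + \<epsilon>)"
      by (rule meanval_reg_le_radius[OF y q(1) t(1) t2 _ bb])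
    also have "\<dots> = \<epsilon> * (\<Lambda> * \<rho> y) powr \<beta>"
      using \<rho> \<epsilon>_pos const by (simp add: \<Lambda>_def powr_mult powr_powr add_pos_pos)
    also have "\<dots> \<le> \<epsilon> * r powr \<beta>" using 3 \<rho> \<Lambda>_pos \<epsilon>_pos const by (intro mult_left_mono powr_mono2) auto
    also have "\<dots> \<le> (b + \<epsilon>) * r powr \<beta>" using b0 by (intro mult_right_mono) auto
    also have "\<dots> = s" by (simp add: s mult.commute)
    finally show ?thesis .
  qed
qed

text \<open>Fatou's lemma along centres \<open>z n\<close> tending to \<open>x\<close> with
  \<open>cand_inf (z n)\<close> tending to at most \<open>reg x\<close>. Halving
  \<open>\<kappa>\<close> keeps the radius admissible at \<open>z n\<close>, where the distance to
  the boundary is eventually at least \<open>\<rho> x / 2\<close>.\<close>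

lemma super_mean_reg:
  assumes x: "x \<in> \<Omega>" and t: "0 < t" "t \<le> \<kappa> / 2 * \<rho> x"
  shows "meanval d x t reg \<le> reg x"
proof -
  have xR: "x \<in> Rd d" by (rule in_Rd[OF x])
  have \<rho>: "0 < \<rho> x" by (rule \<rho>_pos[OF x])
  have V: "0 < vol d t" by (rule vol_pos[OF t(1)])
  have "\<forall>n. \<exists>z. z \<in> \<Omega> \<inter> eball d x (inverse (Suc n)) \<and> cand_inf z < reg x + inverse (Suc n)"
    using reg_approx[OF x] by (metis inverse_Suc of_nat_Suc)
  then obtain z where z: "\<And>n. z n \<in> \<Omega>" "\<And>n. edist d x (z n) < inverse (Suc n)"
    "\<And>n. cand_inf (z n) < reg x + inverse (Suc n)" by (metis IntE Rd.in_mball)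
  have small: "\<forall>\<^sub>F n in sequentially. edist d x (z n) < \<delta>" if "0 < \<delta>" for \<delta>
  proof -
    have "\<forall>\<^sub>F n in sequentially. inverse (real (Suc n)) < \<delta>"
      using LIMSEQ_inverse_real_of_nat that by (rule order_tendstoD)
    then show ?thesis by eventually_elim (use z(2) in \<open>meson less_trans\<close>)
  qed
  let ?B = "ecball d (orig d) t"
  \<comment> \<open>All means are transported to one ball around the origin, so that only the
    integrand depends on the centre.\<close>
  have trans: "(\<integral>\<^sup>+v. indicator ?B v * ennreal (reg (transl d y v)) \<partial>lebP d) = ennreal (vol d t * meanval d y t reg)"
    if y: "y \<in> Rd d" for y
  proof -
    have "(\<integral>\<^sup>+v. indicator (ecball d (transl d y (orig d)) t) v * ennreal (reg v) \<partial>lebP d)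
        = (\<integral>\<^sup>+v. indicator ?B v * ennreal (reg (transl d y v)) \<partial>lebP d)"
      using loc_bdd_measurable[OF loc_bdd_reg] by (intro nn_integral_ecball_aff) (auto simp: orig_in_Rd)
    then show ?thesis
      using nn_integral_ecball_eq_meanval[OF loc_bdd_reg y t(1) reg_nonneg] by (simp add: transl_orig y)
  qed
  have lsc: "ennreal (reg (transl d x v)) \<le> liminf (\<lambda>n. ennreal (reg (transl d (z n) v)))" if v: "v \<in> ?B" for v
  proof -
    let ?y = "transl d x v"
    have "edist d x ?y = edist d (orig d) v"
      using edist_aff[of id d "\<lambda>_. 1" x "orig d" v] transl_orig[OF xR] by simp
    moreover have "t < \<rho> x"
    proof -
      have "\<kappa> / 2 * \<rho> x \<le> 1 / 2 * \<rho> x" using \<kappa>_bounds \<rho> by (intro mult_right_mono) auto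
      then show ?thesis using t \<rho> by linarith
    qed
    ultimately have yO: "?y \<in> \<Omega>" using v by (intro mem_of_edist_less_bdist[OF x xR aff_in_Rd]) auto
    show ?thesis
      unfolding le_Liminf_iff
    proof (intro allI impI)
      fix c assume c: "c < ennreal (reg ?y)"
      define a where "a = enn2real c"
      have a: "c = ennreal a" "0 \<le> a" using c by (auto simp: a_def less_top[symmetric] ennreal_enn2real_if)
      then have "a < reg ?y" using c by (simp add: ennreal_less_iff)
      then obtain \<delta> where \<delta>: "\<delta> > 0" "eball d ?y \<delta> \<subseteq> {y \<in> \<Omega>. a < reg y}"
        using reg_lsc[of a] yO unfolding Rd.openin_mtopology by blast
      show "\<forall>\<^sub>F n in sequentially. c < ennreal (reg (transl d (z n) v))"
        using small[OF \<delta>(1)]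
      proof eventually_elim
        case (elim n)
        have "edist d ?y (transl d (z n) v) = edist d x (z n)"
          by (simp add: edist_def aff_def L2_set_def)
        then have "transl d (z n) v \<in> eball d ?y \<delta>" using elim aff_in_Rd by simp
        then have "a < reg (transl d (z n) v)" using \<delta>(2) by blast
        then show ?case using a by (simp add: ennreal_less_iff)
      qed
    qed
  qed
  have "ennreal (vol d t * meanval d x t reg) = (\<integral>\<^sup>+v. indicator ?B v * ennreal (reg (transl d x v)) \<partial>lebP d)"
    by (rule trans[OF xR, symmetric])
  also have "\<dots> \<le> (\<integral>\<^sup>+v. liminf (\<lambda>n. indicator ?B v * ennreal (reg (transl d (z n) v))) \<partial>lebP d)"
    using lsc by (intro nn_integral_mono) (auto simp: indicator_def)
  also have "\<dots> \<le> liminf (\<lambda>n. \<integral>\<^sup>+v. indicator ?B v * ennreal (reg (transl d (z n) v)) \<partial>lebP d)"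
  proof (rule nn_integral_liminf)
    fix n
    have [measurable]: "(\<lambda>v. reg (transl d (z n) v)) \<in> borel_measurable (lebP d)"
      using measurable_aff loc_bdd_measurable[OF loc_bdd_reg] by (rule measurable_compose) simp
    show "(\<lambda>v. indicator ?B v * ennreal (reg (transl d (z n) v))) \<in> borel_measurable (lebP d)"
      by measurable
  qed
  also have "\<dots> \<le> liminf (\<lambda>n. ennreal (vol d t * (reg x + inverse (Suc n))))"
  proof (rule Liminf_mono)
    have "0 < \<rho> x / 2" using \<rho> by simp
    from small[OF this]
    show "\<forall>\<^sub>F n in sequentially. (\<integral>\<^sup>+v. indicator ?B v * ennreal (reg (transl d (z n) v)) \<partial>lebP d)
        \<le> ennreal (vol d t * (reg x + inverse (Suc n)))"
    proof eventually_elim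
      case (elim n)
      have "\<rho> x / 2 \<le> \<rho> (z n)" using bdist_lipschitz[OF bd_nonempty, of x "z n"] elim by simp
      then have "\<kappa> * (\<rho> x / 2) \<le> \<kappa> * \<rho> (z n)" using \<kappa>_bounds by (intro mult_left_mono) auto
      then have "t \<le> \<kappa> * \<rho> (z n)" using t by simp
      then have "meanval d (z n) t reg \<le> reg x + inverse (Suc n)"
        using meanval_reg_le_cand_inf[OF z(1) t(1), of n] z(3)[of n] by simp
      then show ?case unfolding trans[OF in_Rd[OF z(1)]] using V by (intro ennreal_leI) simp
    qed
  qed
  also have "\<dots> = ennreal (vol d t * reg x)"
  proof (rule lim_imp_Liminf)
    have "(\<lambda>n. vol d t * (reg x + inverse (real (Suc n)))) \<longlonglongrightarrow> vol d t * (reg x + 0)"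
      by (intro tendsto_intros LIMSEQ_inverse_real_of_nat)
    then show "(\<lambda>n. ennreal (vol d t * (reg x + inverse (real (Suc n))))) \<longlonglongrightarrow> ennreal (vol d t * reg x)"
      by (intro tendsto_ennrealI) simp
  qed simp
  finally have "vol d t * meanval d x t reg \<le> vol d t * reg x"
    using V reg_nonneg by (simp add: ennreal_le_iff)
  then show ?thesis using V by simp
qed

text \<open>A Lebesgue number of the one-element cover of \<open>K\<close> by
  \<open>\<Omega>\<close> bounds \<open>\<rho>\<close> from below on \<open>K\<close>, which makes
  the admissible radii uniform there.\<close>

lemma superharmonic_reg: "superharmonic d \<Omega> reg"
proof (rule superharmonic_of_super_mean)
  show "0 < d" using d by simp
  show "loc_bdd d reg" by (rule loc_bdd_reg)
  show "0 \<le> reg x" for x by (rule reg_nonneg)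
  fix K assume K: "compactin (etop d) K" "K \<subseteq> \<Omega>"
  obtain r where r: "r > 0" "\<forall>y\<in>K. \<exists>U\<in>{\<Omega>}. eball d y r \<subseteq> U"
    using Rd.lebesgue_number[OF K(1), of "{\<Omega>}"] K(2) \<Omega>(1) by (metis ccpo_Sup_singleton singletonD)
  have "meanval d y t reg \<le> reg y" if y: "y \<in> K" and t: "0 < t" "t \<le> \<kappa> / 2 * r" for y t
  proof (rule super_mean_reg)
    show yO: "y \<in> \<Omega>" using y K by blast
    have "r \<le> \<rho> y" using r y by (intro le_bdist_of_eball_subset[OF \<Omega>(1) yO bd_nonempty]) auto
    then have "\<kappa> / 2 * r \<le> \<kappa> / 2 * \<rho> y" using \<kappa>_bounds by (intro mult_left_mono) auto
    then show "t \<le> \<kappa> / 2 * \<rho> y" using t by simp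
  qed (rule t)
  moreover have "0 < \<kappa> / 2 * r" using \<kappa>_bounds r by simp
  ultimately show "\<exists>\<delta>>0. \<forall>y\<in>K. \<forall>t. 0 < t \<and> t \<le> \<delta> \<longrightarrow> meanval d y t reg \<le> reg y" by blast
qed

end

theorem theorem5p12:
  fixes \<alpha> \<beta> M :: real
  assumes "0 < \<alpha>" and "0 < M" and "0 < \<beta>" and "\<beta> < \<alpha>"
  shows "\<exists>N>0. \<forall>d\<ge>2. \<forall>\<Omega>. domain_in d \<Omega> \<and> \<Omega> \<subset> Rd d \<and> LHMD d \<Omega> \<alpha> M \<longrightarrow>
    (\<exists>\<phi>. superharmonic d \<Omega> \<phi> \<and>
      (\<forall>x\<in>\<Omega>. inverse N * bdist d \<Omega> x powr \<beta> \<le> \<phi> x \<and> \<phi> x \<le> N * bdist d \<Omega> x powr \<beta>))"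
proof -
  \<comment> \<open>The second entry solves
    \<open>M * \<theta> powr (\<alpha> - \<beta>) = 1 / 4\<close>; the first keeps
    \<open>\<theta>\<close> below 1.\<close>
  define \<theta> where "\<theta> = min (1 / 2) ((1 / (4 * M)) powr (1 / (\<alpha> - \<beta>)))"
  define \<epsilon> where "\<epsilon> = \<theta> powr \<beta> / 8"
  \<comment> \<open>The entries come from \<open>reg_lower_bound\<close>, inverted, and from
    \<open>reg_upper_bound\<close>.\<close>
  define N where "N = max (2 powr \<beta> / \<epsilon>) (2 powr \<beta> * (M + 2 * \<epsilon>))"
  have \<theta>: "0 < \<theta>" "\<theta> < 1" using assms by (auto simp: \<theta>_def)
  have "\<theta> powr (\<alpha> - \<beta>) \<le> ((1 / (4 * M)) powr (1 / (\<alpha> - \<beta>))) powr (\<alpha> - \<beta>)"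
    using assms \<theta> by (intro powr_mono2) (auto simp: \<theta>_def)
  also have "\<dots> = 1 / (4 * M)" using assms by (simp add: powr_powr)
  finally have \<theta>M: "M * \<theta> powr (\<alpha> - \<beta>) \<le> 1 / 4" using assms by (simp add: field_simps)
  have \<epsilon>: "0 < \<epsilon>" using \<theta> by (simp add: \<epsilon>_def)
  have N: "0 < N" "2 powr \<beta> / \<epsilon> \<le> N" "2 powr \<beta> * (M + 2 * \<epsilon>) \<le> N"
    using \<epsilon> by (auto simp: N_def less_max_iff_disj)
  have "inverse N \<le> inverse (2 powr \<beta> / \<epsilon>)" using N(2) \<epsilon> by (intro le_imp_inverse_le) auto
  then have N': "inverse N \<le> \<epsilon> / 2 powr \<beta>" by simp
  show ?thesis
  proof (intro exI[of _ N] conjI allI impI N(1))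
    fix d \<Omega> assume d: "2 \<le> d" and "domain_in d \<Omega> \<and> \<Omega> \<subset> Rd d \<and> LHMD d \<Omega> \<alpha> M"
    then interpret lhmd_domain d \<Omega> \<alpha> \<beta> M \<theta> \<epsilon>
      using assms \<theta> \<theta>M by unfold_locales (auto simp: domain_in_def \<epsilon>_def)
    have "inverse N * bdist d \<Omega> x powr \<beta> \<le> reg x \<and> reg x \<le> N * bdist d \<Omega> x powr \<beta>" if "x \<in> \<Omega>" for x
      using reg_lower_bound[OF that] reg_upper_bound[OF that]
        mult_right_mono[OF N', of "bdist d \<Omega> x powr \<beta>"] mult_right_mono[OF N(3), of "bdist d \<Omega> x powr \<beta>"]
      by simp
    then show "\<exists>\<phi>. superharmonic d \<Omega> \<phi> \<and>
      (\<forall>x\<in>\<Omega>. inverse N * bdist d \<Omega> x powr \<beta> \<le> \<phi> x \<and> \<phi> x \<le> N * bdist d \<Omega> x powr \<beta>)"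
      using superharmonic_reg by blast
  qed
qed

end
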